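(* For an odd positive integer $n=p_1^{r_1}\cdots p_k^{r_k}$ (distinct odd primes $p_i$, $r_i\ge1$; $n=1$ being the empty product) let $$\alpha_n=\prod_{i=1}^k (-1)^{r_i}(-1)^{\frac{p_i^{r_i}-1}{2}} .$$ Let $$\zeta(M,1)=\sum_{k=1}^\infty \frac{(-1)^{k-1}}{2k-1},\qquad \hat\zeta(M,1)=\sum_{k=1}^\infty \frac{\alpha_{2k-1}}{2k-1},$$ both series summed in order of increasing $k$. Then $$\zeta(M,1)=\frac{\pi}{4}\quad\text{and}\quad \hat\zeta(M,1)=\frac12\int_{-1}^1\frac{dx}{\sqrt{1-x^2}}=\int_0^1\frac{dx}{\sqrt{1-x^2}}=\frac{\pi}{2}.$$
   Context: Here $M$ is the rational curve $X^2+Y^2=Z^2$ in $\mathbb{P}^2$ with affine part $x^2+y^2=1$; for odd $n$, $a_n=(-1)^{(n-1)/2}$ and $\alpha_{p^k}=(-1)^k a_{p^k}$ for odd primes $p$, extended multiplicatively. *)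

theory Defs
  imports "HOL-Analysis.Analysis" "HOL-Computational_Algebra.Primes"
begin

text \<open>
  Only odd arguments \<open>n\<close> are meant.  The exponent \<open>r\<close> of the prime \<open>p\<close> in \<open>n\<close> is
  \<open>multiplicity p n\<close>, and the division by \<open>2\<close> is exact because \<open>p ^ r\<close> is odd.
\<close>

definition alpha :: "nat \<Rightarrow> int" where
  "alpha n = (\<Prod>p\<in>prime_factors n.
     (-1) ^ multiplicity p n * (-1) ^ ((p ^ multiplicity p n - 1) div 2))"

text \<open>
  The terms are indexed by \<open>k \<ge> 1\<close>, so the subtractions of natural numbers do not truncate;
  the sums over \<open>k \<ge> 1\<close> are written with \<open>Suc\<close>.  \<open>suminf\<close> is the limit of the
  partial sums in the natural order, and both series converge only conditionally.
\<close>

definition zeta_M_term :: "nat \<Rightarrow> real" where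
  "zeta_M_term k = (-1) ^ (k - 1) / real (2 * k - 1)"

definition zeta_hat_M_term :: "nat \<Rightarrow> real" where
  "zeta_hat_M_term k = of_int (alpha (2 * k - 1)) / real (2 * k - 1)"

definition zeta_M_1 :: real where
  "zeta_M_1 = (\<Sum>k. zeta_M_term (Suc k))"

definition zeta_hat_M_1 :: real where
  "zeta_hat_M_1 = (\<Sum>k. zeta_hat_M_term (Suc k))"

end

theory Submission
  imports Defs "HOL-Complex_Analysis.Complex_Analysis"
begin

text \<open>
  Write \<open>\<chi>\<close> for the nontrivial character modulo \<open>4\<close> and \<open>\<lambda>\<close> for the Liouville function. Then
  \<open>\<alpha> = \<lambda> \<chi>\<close> on odd numbers, and the Euler product gives
  \<open>(\<Sum>n. \<alpha>(n) n\<^sup>-\<^sup>s) * L(s, \<chi>) = (\<Sum>n odd. n\<^sup>-\<^sup>2\<^sup>s)\<close> for \<open>Re s > 1\<close>. At \<open>s = 1\<close> the quotient of the right-hand side by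
  \<open>L(s, \<chi>)\<close> is \<open>(\<pi>\<^sup>2 / 8) / (\<pi> / 4) = \<pi> / 2\<close>. That the conditionally convergent
  series attains this value is as deep as the prime number theorem modulo \<open>4\<close>: Mertens' 3-4-1
  inequality shows \<open>L(s, \<chi>) \<noteq> 0\<close> on \<open>Re s = 1\<close>, so the quotient is holomorphic on a neighbourhood of
  \<open>Re s \<ge> 1\<close>, and Newman's Tauberian theorem for Dirichlet series with bounded coefficients applies.
\<close>

section \<open>Newman's Tauberian theorem\<close>

text \<open>Continuity at s = 1 would give the value of the series only after its convergence is
  known; the Tauberian step supplies both at once, in the shifted variable z = s - 1. Euler products
  occur only in the form "finite product times series tends to 1". This avoids infinite products and
  division, yields nonvanishing for free, and lets identities and inequalities between local factors
  pass to the series. The nonvanishing argument pairs \<chi> with zeta, since the square of \<chi>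
  is principal and differs from the trivial character only at the prime 2. Zeta is used only to the
  right of Re s = 1, through an upper bound: it grows at most like 1 / h at 1 + h and stays bounded
  at 1 + h + 2 i t when t is not 0. No continuation of zeta is needed. The point t = 0 escapes this
  argument and is settled by the Leibniz value of L(1, \<chi>).\<close>

lemma norm_of_nat_powr: "norm (of_nat n powr z :: complex) = real n powr Re z"
  by (subst norm_powr_real_powr) auto

lemma right_semicircleD:
  assumes "z \<in> path_image (part_circlepath 0 R (-(pi/2)) (pi/2))" "R > 0"
  shows "norm z = R" "Re z \<ge> 0"
proof -
  have "z \<in> (\<lambda>x. R * cis x) ` {-(pi/2)..pi/2}"
    using assms(1) by (simp add: path_image_part_circlepath' closed_segment_eq_real_ivl)
  then obtain x where "z = R * cis x" "- (pi/2) \<le> x" "x \<le> pi/2" by force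
  thus "norm z = R" "Re z \<ge> 0" using cos_ge_zero[of x] assms(2) by (simp_all add: norm_mult)
qed

text \<open>
  The integral of \<open>1 / z\<close> is read off from the primitives \<open>Ln z\<close> on the right half of the contour
  and \<open>Ln (- z)\<close> on the left half, so no winding number has to be computed.
\<close>

lemma contour_integral_around_origin:
  fixes R :: real and \<phi> :: "complex \<Rightarrow> complex" and p :: "real \<Rightarrow> complex"
  defines "\<gamma> \<equiv> part_circlepath 0 R (-(pi/2)) (pi/2)"
  assumes R: "R > 0" and C: "open C" "convex C" and hol: "\<phi> holomorphic_on C"
    and arc: "path_image \<gamma> \<subseteq> C"
    and p: "valid_path p" "path_image p \<subseteq> C - \<real>\<^sub>\<ge>\<^sub>0"
    and ends: "pathstart p = \<i> * R" "pathfinish p = - \<i> * R"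
  shows "contour_integral \<gamma> (\<lambda>z. \<phi> z / z) + contour_integral p (\<lambda>z. \<phi> z / z) = 2 * pi * \<i> * \<phi> 0"
    and "(\<lambda>z. \<phi> z / z) contour_integrable_on \<gamma>" and "(\<lambda>z. \<phi> z / z) contour_integrable_on p"
proof -
  \<comment> \<open>The difference quotient removes the pole: \<phi>(z) / z = \<psi>(z) + \<phi>(0)
    / z. Cauchy's theorem on the convex set disposes of \<psi>, so only the integral of 1 / z
    remains.\<close>
  define \<psi> where "\<psi> = (\<lambda>z. if z = 0 then deriv \<phi> 0 else (\<phi> z - \<phi> 0) / (z - 0))"
  have hol': "\<psi> holomorphic_on C"
    unfolding \<psi>_def by (rule pole_lemma_open) (use hol C in auto)
  have arc_ends: "pathstart \<gamma> = - \<i> * R" "pathfinish \<gamma> = \<i> * R"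
    unfolding \<gamma>_def by (simp_all add: exp_eq_polar cis_conv_exp[symmetric] exp_minus complex_eq_iff)
  have va: "valid_path \<gamma>" by (simp add: \<gamma>_def)
  have arc_nonpos: "z \<notin> \<real>\<^sub>\<le>\<^sub>0" if "z \<in> path_image \<gamma>" for z
    using right_semicircleD[OF that[unfolded \<gamma>_def] R] R
    by (auto simp: complex_nonpos_Reals_iff cmod_def)
  have nz_arc: "z \<noteq> 0" if "z \<in> path_image \<gamma>" for z using arc_nonpos[OF that] by auto
  have nz_p: "z \<noteq> 0" if "z \<in> path_image p" for z using p that by auto
  have inv_arc: "((\<lambda>z. 1 / z) has_contour_integral (Ln (pathfinish \<gamma>) - Ln (pathstart \<gamma>))) \<gamma>"
    by (rule contour_integral_primitive[where S = "- \<real>\<^sub>\<le>\<^sub>0"])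
       (use va arc_nonpos in \<open>auto intro!: derivative_eq_intros simp: divide_inverse\<close>)
  have inv_p: "((\<lambda>z. 1 / z) has_contour_integral (Ln (- pathfinish p) - Ln (- pathstart p))) p"
  proof (rule contour_integral_primitive[where S = "- \<real>\<^sub>\<ge>\<^sub>0"])
    fix z :: complex assume z: "z \<in> - \<real>\<^sub>\<ge>\<^sub>0"
    hence "-z \<notin> \<real>\<^sub>\<le>\<^sub>0" by (auto simp: complex_nonneg_Reals_iff complex_nonpos_Reals_iff)
    moreover have "z \<noteq> 0" using z by auto
    ultimately show "((\<lambda>z. Ln (- z)) has_field_derivative 1 / z) (at z within - \<real>\<^sub>\<ge>\<^sub>0)"
      by (auto intro!: derivative_eq_intros simp: divide_simps)
  qed (use p in auto)
  have LnR: "Ln (\<i> * R) = Ln R + \<i> * (pi/2)" "Ln (- \<i> * R) = Ln R - \<i> * (pi/2)"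
    using R Ln_times_of_real[of R \<i>] Ln_times_of_real[of R "-\<i>"] by (simp_all add: mult.commute Ln_of_real)
  \<comment> \<open>Each half of the contour turns the argument by pi; together they produce the
    factor 2 pi i.\<close>
  have log_diff: "Ln (pathfinish \<gamma>) - Ln (pathstart \<gamma>) = \<i> * pi"
    "Ln (- pathfinish p) - Ln (- pathstart p) = \<i> * pi"
    using LnR by (simp_all add: arc_ends ends)
  have "(\<psi> has_contour_integral 0) (\<gamma> +++ p)"
  proof (rule Cauchy_theorem_convex_simple[OF hol' C(2)])
    show "path_image (\<gamma> +++ p) \<subseteq> C"
      using arc p by (intro order_trans[OF path_image_join_subset]) auto
  qed (use va p ends arc_ends in \<open>auto intro: valid_path_join\<close>)
  hence closed0: "contour_integral (\<gamma> +++ p) \<psi> = 0" by (rule contour_integral_unique)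
  have int: "\<psi> contour_integrable_on \<gamma>" "\<psi> contour_integrable_on p"
    using p arc by (auto intro!: contour_integrable_holomorphic_simple[OF hol' C(1)] va)
  have sum0: "contour_integral \<gamma> \<psi> + contour_integral p \<psi> = 0"
    using closed0 int va p by (simp add: arc_ends ends)
  have split: "((\<lambda>z. \<phi> z / z) has_contour_integral (contour_integral q \<psi> + \<phi> 0 * I)) q"
    if "\<psi> contour_integrable_on q" "((\<lambda>z. 1 / z) has_contour_integral I) q" "\<And>z. z \<in> path_image q \<Longrightarrow> z \<noteq> 0" for q I
  proof (rule has_contour_integral_eq)
    show "((\<lambda>z. \<psi> z + \<phi> 0 * (1 / z)) has_contour_integral (contour_integral q \<psi> + \<phi> 0 * I)) q"
      by (intro has_contour_integral_add has_contour_integral_lmul that has_contour_integral_integral)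
  qed (use that in \<open>auto simp: \<psi>_def field_simps\<close>)
  have s1: "((\<lambda>z. \<phi> z / z) has_contour_integral
      (contour_integral \<gamma> \<psi> + \<phi> 0 * (Ln (pathfinish \<gamma>) - Ln (pathstart \<gamma>)))) \<gamma>"
    by (rule split[OF int(1) inv_arc]) (rule nz_arc)
  have s2: "((\<lambda>z. \<phi> z / z) has_contour_integral
      (contour_integral p \<psi> + \<phi> 0 * (Ln (- pathfinish p) - Ln (- pathstart p)))) p"
    by (rule split[OF int(2) inv_p]) (rule nz_p)
  show "(\<lambda>z. \<phi> z / z) contour_integrable_on \<gamma>" "(\<lambda>z. \<phi> z / z) contour_integrable_on p"
    using s1 s2 by (auto simp: contour_integrable_on_def)
  show "contour_integral \<gamma> (\<lambda>z. \<phi> z / z) + contour_integral p (\<lambda>z. \<phi> z / z) = 2 * pi * \<i> * \<phi> 0"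
    unfolding contour_integral_unique[OF s1] contour_integral_unique[OF s2] log_diff
    using sum0 by (simp add: algebra_simps add_eq_0_iff2)
qed

text \<open>The end points may lie on the imaginary axis, where the power has modulus 1, so the
  convergence to 0 is not uniform on the segment. It is pointwise inside, with the power bounded by
  1, and dominated convergence over the open parameter interval suffices.\<close>

lemma contour_integral_linepath_powr_tendsto_0:
  fixes h :: "complex \<Rightarrow> complex"
  assumes h: "continuous_on (closed_segment a b) h"
    and neg: "\<And>z. z \<in> open_segment a b \<Longrightarrow> Re z < 0"
  shows "(\<lambda>N. contour_integral (linepath a b) (\<lambda>z. of_nat (Suc N) powr z * h z)) \<longlonglongrightarrow> 0"
proof (cases "a = b")
  case False
  define g where "g = (\<lambda>N x. of_nat (Suc N) powr linepath a b x * h (linepath a b x) * (b - a))"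
  have cont: "continuous_on (closed_segment a b) (\<lambda>z. of_nat (Suc N) powr z * h z)" for N
    by (intro continuous_intros h) (auto simp: of_nat_Suc[symmetric] simp del: of_nat_Suc)
  have Re_neg: "Re (linepath a b x) < 0" if "x \<in> {0<..<1}" for x
    using that False by (intro neg) (auto simp: in_segment linepath_def intro!: exI[of _ x])
  have in_seg: "linepath a b x \<in> closed_segment a b" if "x \<in> {0<..<1}" for x
    using that by (auto simp: in_segment linepath_def intro!: exI[of _ x])
  obtain B where B: "\<And>z. z \<in> closed_segment a b \<Longrightarrow> norm (h z) \<le> B"
    using compact_imp_bounded[OF compact_continuous_image[OF h compact_segment]]
    by (auto simp: bounded_iff)
  have "(\<lambda>N. integral {0<..<1} (g N)) \<longlonglongrightarrow> integral {0<..<1::real} (\<lambda>_. 0)"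
  proof (rule dominated_convergence(2))
    fix N
    have "(\<lambda>z. of_nat (Suc N) powr z * h z) contour_integrable_on linepath a b"
      by (rule contour_integrable_continuous_linepath[OF cont])
    thus "g N integrable_on {0<..<1}"
      by (simp add: contour_integrable_on g_def integrable_on_open_interval_real)
  next
    show "(\<lambda>_. B * norm (b - a)) integrable_on {0<..<1::real}"
      unfolding integrable_on_open_interval_real by (rule integrable_const_ivl)
  next
    fix N x assume x: "x \<in> {0<..<1::real}"
    have "real (Suc N) powr Re (linepath a b x) \<le> real (Suc N) powr 0"
      using Re_neg[OF x] by (intro powr_mono) auto
    hence "real (Suc N) powr Re (linepath a b x) \<le> 1" by simp
    moreover have "norm (h (linepath a b x)) \<le> B" using B in_seg[OF x] by blast
    ultimately show "norm (g N x) \<le> B * norm (b - a)"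
      unfolding g_def norm_mult norm_of_nat_powr
      by (intro mult_right_mono) (auto intro: order_trans[OF mult_left_le_one_le])
  next
    fix x assume x: "x \<in> {0<..<1::real}"
    have "(\<lambda>N. real (Suc N) powr Re (linepath a b x)) \<longlonglongrightarrow> 0"
      using Re_neg[OF x] by (intro tendsto_neg_powr filterlim_compose[OF filterlim_real_sequentially filterlim_Suc])
    hence "(\<lambda>N. of_nat (Suc N) powr linepath a b x :: complex) \<longlonglongrightarrow> 0"
      by (intro tendsto_norm_zero_cancel[where f = "\<lambda>N. of_nat (Suc N) powr linepath a b x"]) (simp only: norm_of_nat_powr)
    thus "(\<lambda>N. g N x) \<longlonglongrightarrow> 0"
      unfolding g_def by (intro tendsto_mult_left_zero)
  qed
  moreover have "contour_integral (linepath a b) (\<lambda>z. of_nat (Suc N) powr z * h z) = integral {0<..<1} (g N)" for N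
    by (simp add: contour_integral_integral g_def integral_open_interval_real)
  ultimately show ?thesis by simp
qed simp

text \<open>Comparison with the integral of \<open>u powr (x - 1)\<close>, carried out by the mean
  value theorem in an induction. The integrand is increasing for x at least 1 and decreasing below,
  whence the two cases; the extra summand is the last term, needed in the increasing case.\<close>

lemma sum_powr_le:
  fixes x :: real
  assumes x: "x > 0" and N: "N > 0"
  shows "(\<Sum>n<N. real (Suc n) powr (x - 1)) \<le> real N powr x / x + real N powr (x - 1)"
proof -
  have deriv: "((\<lambda>u. u powr x / x) has_real_derivative u powr (x - 1)) (at u)" if "u > 0" for u
    using that x by (auto intro!: derivative_eq_intros)
  show ?thesis
  proof (cases "x \<ge> 1")
    case True
    have "(\<Sum>n<Suc M. real (Suc n) powr (x - 1)) \<le> real (Suc M) powr x / x + real (Suc M) powr (x - 1)" for M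
    proof (induction M)
      case (Suc M)
      have "\<exists>z>real (Suc M). z < real (Suc (Suc M)) \<and>
         real (Suc (Suc M)) powr x / x - real (Suc M) powr x / x = (real (Suc (Suc M)) - real (Suc M)) * z powr (x - 1)"
        by (rule MVT2) (auto intro!: deriv)
      then obtain z where z: "z > real (Suc M)" 
        "real (Suc (Suc M)) powr x / x - real (Suc M) powr x / x = z powr (x - 1)" by auto
      have "real (Suc M) powr (x - 1) \<le> z powr (x - 1)" using z True by (intro powr_mono2) auto
      with Suc.IH z(2) show ?case by simp
    qed (use x in auto)
    from this[of "N - 1"] N show ?thesis by simp
  next
    case False
    have "(\<Sum>n<Suc M. real (Suc n) powr (x - 1)) \<le> real (Suc M) powr x / x" for M
    proof (induction M)
      case 0
      show ?case using False x by simp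
    next
      case (Suc M)
      have "\<exists>z>real (Suc M). z < real (Suc (Suc M)) \<and>
         real (Suc (Suc M)) powr x / x - real (Suc M) powr x / x = (real (Suc (Suc M)) - real (Suc M)) * z powr (x - 1)"
        by (rule MVT2) (auto intro!: deriv)
      then obtain z where z: "z > real (Suc M)" "z < real (Suc (Suc M))"
        "real (Suc (Suc M)) powr x / x - real (Suc M) powr x / x = z powr (x - 1)" by auto
      have "real (Suc (Suc M)) powr (x - 1) \<le> z powr (x - 1)" using z False by (intro powr_mono2') auto
      with Suc.IH z(3) show ?case by simp
    qed
    from this[of "N - 1"] N show ?thesis by (simp add: add_increasing2)
  qed
qed

text \<open>The mean value theorem bounds each term by a difference of consecutive values of
  \<open>u powr (- x) / x\<close>, and these differences telescope.\<close>

lemma powr_tail_sums: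
  fixes x :: real
  assumes x: "x > 0" and N: "N > 0"
  shows "summable (\<lambda>n. real (Suc (n + N)) powr (-1 - x))"
    and "(\<Sum>n. real (Suc (n + N)) powr (-1 - x)) \<le> real N powr (- x) / x"
proof -
  define g where "g = (\<lambda>n. real (n + N) powr (- x) / x)"
  have "g \<longlonglongrightarrow> 0 / x" unfolding g_def
    using x by (intro tendsto_divide tendsto_const tendsto_neg_powr filterlim_compose[OF filterlim_real_sequentially] filterlim_add_const_nat_at_top) auto
  hence sums: "(\<lambda>n. g n - g (Suc n)) sums (g 0 - 0)"
    using telescope_sums'[of g 0] by simp
  have le: "real (Suc (n + N)) powr (-1 - x) \<le> g n - g (Suc n)" for n
  proof -
    have "\<exists>z>real (n + N). z < real (Suc (n + N)) \<and>
       - (real (Suc (n + N)) powr (- x) / x) - - (real (n + N) powr (- x) / x) = 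
         (real (Suc (n + N)) - real (n + N)) * z powr (-1 - x)"
      by (rule MVT2) (use x N in \<open>auto intro!: derivative_eq_intros simp: minus_diff_commute\<close>)
    then obtain z where z: "z > real (n + N)" "z < real (Suc (n + N))" "g n - g (Suc n) = z powr (-1 - x)"
      by (auto simp: g_def add_ac)
    have "real (Suc (n + N)) powr (-1 - x) \<le> z powr (-1 - x)"
      using z x N by (intro powr_mono2') auto
    with z show ?thesis by simp
  qed
  show 1: "summable (\<lambda>n. real (Suc (n + N)) powr (-1 - x))"
    by (rule summable_comparison_test'[OF sums_summable[OF sums]]) (use le in auto)
  have "(\<Sum>n. real (Suc (n + N)) powr (-1 - x)) \<le> (\<Sum>n. g n - g (Suc n))"
    by (rule suminf_le[OF le 1 sums_summable[OF sums]])
  thus "(\<Sum>n. real (Suc (n + N)) powr (-1 - x)) \<le> real N powr (- x) / x"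
    using sums by (simp add: sums_iff g_def)
qed

text \<open>On the circle \<open>R\<^sup>2 = z * cnj z\<close>, which turns the kernel into
  \<open>(z + cnj z) / R\<^sup>2\<close>, a real number proportional to \<open>Re z\<close>.\<close>

lemma norm_newman_kernel:
  fixes z :: complex and R :: real
  assumes "norm z = R" "R > 0"
  shows "norm ((1 + z\<^sup>2 / R\<^sup>2) / z) = 2 * \<bar>Re z\<bar> / R\<^sup>2"
proof -
  have nz: "z \<noteq> 0" using assms by auto
  have "complex_of_real (R\<^sup>2) = z * cnj z"
    using assms by (simp add: complex_norm_square[symmetric])
  hence "(1 + z\<^sup>2 / R\<^sup>2) / z = (z + cnj z) / R\<^sup>2"
    using nz assms by (simp add: field_simps power2_eq_square)
  also have "\<dots> = of_real (2 * Re z / R\<^sup>2)"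
    by (simp add: complex_add_cnj)
  finally show ?thesis by (simp only: norm_of_real abs_divide abs_mult) auto
qed

text \<open>
  The partial sums \<open>S\<close> are entire, so Cauchy's formula for them may use the full circle; the formula
  for \<open>G\<close> uses the right semicircle and, on the left, two segments staying in the domain of \<open>G\<close>.
  The kernel \<open>N powr z * (1 + z\<^sup>2 / R\<^sup>2) / z\<close> has modulus \<open>2 * N powr Re z * \<bar>Re z\<bar> / R\<^sup>2\<close> on the
  circle, which cancels the growth of both the tail \<open>G - S\<close> and of \<open>S\<close> near the imaginary axis.
\<close>

lemma newman_estimate:
  fixes a :: "nat \<Rightarrow> complex" and R :: real
  defines "S \<equiv> \<lambda>N z. \<Sum>n<N. a n * of_nat (Suc n) powr (-1 - z)"
  assumes a: "\<And>n. norm (a n) \<le> 1"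
    and U: "open U" "{z. Re z \<ge> 0} \<subseteq> U" and G: "G holomorphic_on U"
    and sums: "\<And>z. Re z > 0 \<Longrightarrow> (\<lambda>n. a n * of_nat (Suc n) powr (-1 - z)) sums G z"
    and R: "R > 0"
  obtains b where "b \<longlonglongrightarrow> 0" "\<And>N. norm (G 0 - S (Suc N) 0) \<le> 2 / R + b N"
proof -
  define D where "D = cball 0 R \<inter> {z. Re z \<ge> 0}"
  have D: "compact D" "convex D" "D \<subseteq> U"
    using U unfolding D_def
    by (auto intro!: compact_Int_closed closed_halfspace_Re_ge convex_Int convex_halfspace_Re_ge)
  obtain e where e: "e > 0" "(\<Union>z\<in>D. ball z e) \<subseteq> U"
    using compact_subset_open_imp_ball_epsilon_subset[OF D(1) U(1) D(3)] .
  \<comment> \<open>As a Minkowski sum of the convex half disc and a ball, C is convex; read as a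
    union of balls of radius e, it is open and inside U. Both descriptions are used.\<close>
  define C where "C = (\<Union>z\<in>D. \<Union>w\<in>ball 0 e. {z + w})"
  have C_eq: "C = (\<Union>z\<in>D. ball z e)"
  proof (intro equalityI subsetI)
    fix w assume "w \<in> (\<Union>z\<in>D. ball z e)"
    then obtain z where "z \<in> D" "w \<in> ball z e" by blast
    moreover from this have "w = z + (w - z)" "w - z \<in> ball 0 e"
      by (auto simp: dist_norm norm_minus_commute)
    ultimately show "w \<in> C" unfolding C_def by blast
  next
    fix w assume "w \<in> C"
    then obtain z y where "z \<in> D" "y \<in> ball 0 e" "w = z + y" unfolding C_def by blast
    thus "w \<in> (\<Union>z\<in>D. ball z e)" by (intro UN_I[of z]) (auto simp: dist_norm)
  qed
  have C: "open C" "convex C" "C \<subseteq> U"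
    using e D convex_sums[OF D(2) convex_ball[of 0 e]] 
    by (auto simp: C_eq C_def[symmetric])
  have DC: "D \<subseteq> C" using e by (auto simp: C_eq)
  define \<gamma> where "\<gamma> = part_circlepath 0 R (-(pi/2)) (pi/2)"
  define \<eta> where "\<eta> = part_circlepath 0 R (pi/2) (3 * pi/2)"
  \<comment> \<open>Any d strictly between 0 and e would do: the corner -d of the left contour is
    then in the ball around 0, hence in C, and convexity puts both segments in C.\<close>
  define d where "d = e / 2"
  define p where "p = linepath (\<i> * R) (- of_real d) +++ linepath (- of_real d) (- \<i> * R)"
  have \<gamma>: "norm z = R \<and> Re z \<ge> 0" if "z \<in> path_image \<gamma>" for z
    using right_semicircleD[OF that[unfolded \<gamma>_def] R] by blast
  have \<eta>: "norm z = R \<and> Re z \<le> 0" if z: "z \<in> path_image \<eta>" for z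
  proof -
    have "z \<in> (\<lambda>x. R * cis x) ` {pi/2..3*pi/2}"
      using z by (simp add: \<eta>_def path_image_part_circlepath' closed_segment_eq_real_ivl)
    then obtain x where x: "z = R * cis x" "pi/2 \<le> x" "x \<le> 3*pi/2" by force
    have "cos x \<le> 0" using cos_ge_zero[of "x - pi"] x by (simp add: cos_diff)
    thus ?thesis using R x by (simp add: norm_mult mult_nonneg_nonpos)
  qed
  have nonneg: "z \<notin> \<real>\<^sub>\<ge>\<^sub>0" if "Re z \<le> 0" "z \<noteq> 0" for z
    using that by (auto simp: complex_nonneg_Reals_iff complex_eq_iff)
  have \<gamma>C: "path_image \<gamma> \<subseteq> C" using \<gamma> DC by (auto simp: D_def)
  have d: "d > 0" using e by (simp add: d_def)
  have seg_sub: "closed_segment (\<i> * R) (- of_real d) \<subseteq> C" "closed_segment (- of_real d) (- \<i> * R) \<subseteq> C"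
  proof -
    have "0 \<in> D" "\<i> * R \<in> D" "- \<i> * R \<in> D" using R by (auto simp: D_def norm_mult)
    moreover from \<open>0 \<in> D\<close> have "- of_real d \<in> C" using e by (auto simp: C_eq d_def intro!: bexI[of _ 0])
    ultimately show "closed_segment (\<i> * R) (- of_real d) \<subseteq> C" "closed_segment (- of_real d) (- \<i> * R) \<subseteq> C"
      using DC by (intro closed_segment_subset[OF _ _ C(2)]; blast)+
  qed
  have Re_neg: "Re z < 0 \<or> z = w" if z: "z \<in> closed_segment w (- of_real d)" and w: "Re w = 0" for z w
  proof -
    obtain u where u: "0 \<le> u" "z = (1 - u) *\<^sub>R w + u *\<^sub>R (- of_real d)" using z by (auto simp: in_segment)
    have "Re z = - (u * d)" using u(2) w by simp
    thus ?thesis using u d by (cases "u = 0") auto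
  qed
  have Im_zero: "Re z < 0 \<or> z = \<i> * R" if "z \<in> closed_segment (\<i> * R) (- of_real d)" for z
    by (rule Re_neg[OF that]) simp
  have Im_zero': "Re z < 0 \<or> z = -\<i> * R" if "z \<in> closed_segment (- of_real d) (- \<i> * R)" for z
    by (rule Re_neg) (use that closed_segment_commute in auto)
  have seg_nz: "Re z \<le> 0 \<and> z \<noteq> 0" if "z \<in> closed_segment (\<i> * R) (- of_real d) \<union> closed_segment (- of_real d) (- \<i> * R)" for z
    using that Im_zero[of z] Im_zero'[of z] R by (auto simp: complex_eq_iff)
  have p_image: "path_image p = closed_segment (\<i> * R) (- of_real d) \<union> closed_segment (- of_real d) (- \<i> * R)"
    by (simp add: p_def path_image_join)
  have p: "valid_path p" "path_image p \<subseteq> C - \<real>\<^sub>\<ge>\<^sub>0" "pathstart p = \<i> * R" "pathfinish p = - \<i> * R"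
    using seg_sub seg_nz nonneg unfolding p_image by (auto simp: p_def intro!: valid_path_join)
  have \<eta>': "valid_path \<eta>" "path_image \<eta> \<subseteq> UNIV - \<real>\<^sub>\<ge>\<^sub>0" "pathstart \<eta> = \<i> * R" "pathfinish \<eta> = - \<i> * R"
  proof -
    show "path_image \<eta> \<subseteq> UNIV - \<real>\<^sub>\<ge>\<^sub>0" using \<eta> nonneg R by force
    have "3 * pi / 2 = pi + pi / 2" by simp
    hence "cis (3 * pi / 2) = - \<i>" by (simp only: cis_mult[symmetric] cis_pi cis_pi_half) simp
    with cis_pi_half show "pathstart \<eta> = \<i> * R" "pathfinish \<eta> = - \<i> * R"
      by (simp_all add: \<eta>_def cis_conv_exp)
  qed (simp add: \<eta>_def)
  define K where "K = (\<lambda>N (z::complex). of_nat (Suc N) powr z * (1 + z\<^sup>2 / R\<^sup>2))"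
  \<comment> \<open>These are the contributions that depend on N: the excess of the bound for the
    partial sum on the left arc, and the integral of G over the two segments.\<close>
  define b where "b = (\<lambda>N. 1 / real (Suc N) + norm (contour_integral p (\<lambda>z. G z * K N z / z)) / (2 * pi))"
  have normK: "norm (K N z / z) = real (Suc N) powr Re z * (2 * \<bar>Re z\<bar> / R\<^sup>2)" if "norm z = R" for N z
  proof -
    have "norm (K N z / z) = norm (of_nat (Suc N) powr z :: complex) * norm ((1 + z\<^sup>2 / R\<^sup>2) / z)"
      by (simp add: K_def norm_mult norm_divide del: of_nat_Suc)
    thus ?thesis by (simp only: norm_newman_kernel[OF that R] norm_of_nat_powr)
  qed
  have K0: "K N 0 = 1" for N using of_nat_Suc[of N] by (simp add: K_def del: of_nat_Suc)
  have holK: "K N holomorphic_on X" for N X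
    unfolding K_def by (intro holomorphic_intros) (auto simp: of_nat_Suc[symmetric] simp del: of_nat_Suc)
  have holS: "S N holomorphic_on X" for N X
    unfolding S_def by (intro holomorphic_intros) (auto simp: of_nat_Suc[symmetric] simp del: of_nat_Suc)
  show thesis
  proof
    have "(\<lambda>N. contour_integral (linepath u v) (\<lambda>z. of_nat (Suc N) powr z * (G z * (1 + z\<^sup>2 / R\<^sup>2) / z))) \<longlonglongrightarrow> 0"
      if "(u, v) \<in> {(\<i> * R, - of_real d), (- of_real d, - \<i> * R)}" for u v
    proof (rule contour_integral_linepath_powr_tendsto_0)
      have "closed_segment u v \<subseteq> U" "0 \<notin> closed_segment u v" using that seg_sub seg_nz C(3) by auto
      thus "continuous_on (closed_segment u v) (\<lambda>z. G z * (1 + z\<^sup>2 / R\<^sup>2) / z)"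
        using R by (intro continuous_intros continuous_on_subset[OF holomorphic_on_imp_continuous_on[OF G]]) auto
      show "Re z < 0" if "z \<in> open_segment u v" for z
        using that \<open>(u, v) \<in> _\<close> Im_zero Im_zero' by (auto simp: open_segment_def)
    qed
    note lim = tendsto_add[OF this this, of "\<i> * R" "- of_real d" "- of_real d" "- \<i> * R"]
    have "contour_integral p (\<lambda>z. G z * K N z / z) =
            contour_integral (linepath (\<i> * R) (- of_real d)) (\<lambda>z. of_nat (Suc N) powr z * (G z * (1 + z\<^sup>2 / R\<^sup>2) / z)) +
            contour_integral (linepath (- of_real d) (- \<i> * R)) (\<lambda>z. of_nat (Suc N) powr z * (G z * (1 + z\<^sup>2 / R\<^sup>2) / z))" for N
    proof -
      have *: "(\<lambda>z. G z * K N z / z) = (\<lambda>z. of_nat (Suc N) powr z * (G z * (1 + z\<^sup>2 / R\<^sup>2) / z))"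
        by (auto simp: K_def fun_eq_iff)
      have "(\<lambda>z. G z * K N z / z) contour_integrable_on linepath u v"
        if "(u, v) \<in> {(\<i> * R, - of_real d), (- of_real d, - \<i> * R)}" for u v
      proof (rule contour_integrable_continuous_linepath)
        have "closed_segment u v \<subseteq> U" "0 \<notin> closed_segment u v" using that seg_sub seg_nz C(3) by auto
        thus "continuous_on (closed_segment u v) (\<lambda>z. G z * K N z / z)"
          using R by (intro continuous_intros continuous_on_subset[OF holomorphic_on_imp_continuous_on[OF G]] 
                holomorphic_on_imp_continuous_on[OF holK]) auto
      qed
      thus ?thesis unfolding p_def *[symmetric] by (intro contour_integral_join) auto
    qed
    with lim have "(\<lambda>N. contour_integral p (\<lambda>z. G z * K N z / z)) \<longlonglongrightarrow> 0" by simp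
    hence "b \<longlonglongrightarrow> 0 + norm (0::complex) / (2 * pi)"
      unfolding b_def by (intro tendsto_intros LIMSEQ_Suc[OF lim_1_over_n]) auto
    thus "b \<longlonglongrightarrow> 0" by simp
  next
    fix N
    have bound1: "norm ((G z - S (Suc N) z) * K N z / z) \<le> 2 / R\<^sup>2" if z: "z \<in> path_image \<gamma>" for z
    proof (cases "Re z = 0")
      \<comment> \<open>These points are the ends of the arc, where the series is not assumed to
        converge; the kernel vanishes there.\<close>
      case True
      hence "norm (K N z / z) = 0" using normK[of z N] \<gamma>[OF z] by simp
      thus ?thesis by auto
    next
      case False
      with \<gamma>[OF z] have pos: "Re z > 0" and nz: "norm z = R" by auto
      define x where "x = Re z"
      have "(\<lambda>n. a (n + Suc N) * of_nat (Suc (n + Suc N)) powr (-1 - z)) sums (G z - S (Suc N) z)"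
        using sums_split_initial_segment[OF sums[OF pos], of "Suc N"] by (simp only: S_def)
      hence "norm (G z - S (Suc N) z) = norm (\<Sum>n. a (n + Suc N) * of_nat (Suc (n + Suc N)) powr (-1 - z))"
        by (simp only: sums_iff)
      also have "\<dots> \<le> (\<Sum>n. real (Suc (n + Suc N)) powr (-1 - x))"
      proof (rule norm_suminf_le)
        fix n show "norm (a (n + Suc N) * of_nat (Suc (n + Suc N)) powr (-1 - z)) \<le> real (Suc (n + Suc N)) powr (-1 - x)"
          unfolding norm_mult norm_of_nat_powr x_def using a[of "n + Suc N"]
          by (auto intro: mult_left_le_one_le)
      qed (use powr_tail_sums[of x "Suc N"] pos in \<open>auto simp: x_def\<close>)
      also have "\<dots> \<le> real (Suc N) powr (- x) / x"
        using powr_tail_sums(2)[of x "Suc N"] pos by (simp add: x_def)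
      finally have "norm (G z - S (Suc N) z) * norm (K N z / z) \<le> (real (Suc N) powr (- x) / x) * norm (K N z / z)"
        by (intro mult_right_mono) auto
      also have "\<dots> = 2 / R\<^sup>2"
        using pos normK[OF nz, of N] by (simp add: x_def powr_minus field_simps)
      finally show ?thesis by (simp add: norm_mult norm_divide)
    qed
    have bound2: "norm (S (Suc N) z * K N z / z) \<le> 2 / R\<^sup>2 + 2 / (R * Suc N)" if z: "z \<in> path_image \<eta>" for z
    proof (cases "Re z = 0")
      case True
      hence "norm (K N z / z) = 0" using normK[of z N] \<eta>[OF z] by simp
      thus ?thesis using R by auto
    next
      case False
      with \<eta>[OF z] have neg: "Re z < 0" and nz: "norm z = R" by auto
      define x where "x = - Re z"
      have x: "x > 0" "x \<le> R" using neg nz abs_Re_le_cmod[of z] by (auto simp: x_def)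
      have "norm (S (Suc N) z) \<le> (\<Sum>n<Suc N. real (Suc n) powr (x - 1))"
        unfolding S_def
      proof (rule sum_norm_le)
        fix n show "norm (a n * of_nat (Suc n) powr (-1 - z)) \<le> real (Suc n) powr (x - 1)"
          unfolding norm_mult norm_of_nat_powr using a[of n]
          by (simp add: x_def minus_diff_commute mult_left_le_one_le del: of_nat_Suc)
      qed
      also have "\<dots> \<le> real (Suc N) powr x / x + real (Suc N) powr (x - 1)"
        by (rule sum_powr_le) (use x in auto)
      finally have "norm (S (Suc N) z) * norm (K N z / z) \<le> (real (Suc N) powr x / x + real (Suc N) powr (x - 1)) * norm (K N z / z)"
        by (intro mult_right_mono) auto
      also have "\<dots> = 2 / R\<^sup>2 + (2 * x / R\<^sup>2) / Suc N"
      proof -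
        have "norm (K N z / z) = real (Suc N) powr (- x) * (2 * x / R\<^sup>2)"
          using normK[OF nz, of N] neg by (simp add: x_def)
        thus ?thesis using x R
          by (simp add: powr_minus powr_diff field_simps del: of_nat_Suc)
      qed
      also have "\<dots> \<le> 2 / R\<^sup>2 + 2 / (R * Suc N)"
      proof -
        have "2 * x / R\<^sup>2 \<le> 2 / R" using x R by (simp add: field_simps power2_eq_square)
        hence "(2 * x / R\<^sup>2) / Suc N \<le> (2 / R) / Suc N" by (intro divide_right_mono) auto
        thus ?thesis by simp
      qed
      finally show ?thesis by (simp add: norm_mult norm_divide)
    qed
    have holG: "G holomorphic_on C" using G C(3) by (rule holomorphic_on_subset)
    note cG = contour_integral_around_origin[OF R C(1,2) holomorphic_on_mult[OF holG holK[of N]] \<gamma>C[unfolded \<gamma>_def] p, folded \<gamma>_def]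
    note cS = contour_integral_around_origin[OF R open_UNIV convex_UNIV holomorphic_on_mult[OF holS[of "Suc N"] holK[of N]] subset_UNIV \<eta>', folded \<gamma>_def]
    have diff_eq: "(\<lambda>z. (G z - S (Suc N) z) * K N z / z) = (\<lambda>z. G z * K N z / z - S (Suc N) z * K N z / z)"
      by (simp only: left_diff_distrib diff_divide_distrib)
    \<comment> \<open>Since \<open>K N 0 = 1\<close>, subtracting the two Cauchy formulas isolates
      the error at 0. On the common right arc only the tail of the series survives, while each
      function keeps its own left contour.\<close>
    have "2 * pi * \<i> * (G 0 - S (Suc N) 0) =
        contour_integral \<gamma> (\<lambda>z. G z * K N z / z) - contour_integral \<gamma> (\<lambda>z. S (Suc N) z * K N z / z)
        + contour_integral p (\<lambda>z. G z * K N z / z) - contour_integral \<eta> (\<lambda>z. S (Suc N) z * K N z / z)"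
      using cG(1) cS(1) by (simp add: K0 algebra_simps)
    also have "contour_integral \<gamma> (\<lambda>z. G z * K N z / z) - contour_integral \<gamma> (\<lambda>z. S (Suc N) z * K N z / z) =
        contour_integral \<gamma> (\<lambda>z. (G z - S (Suc N) z) * K N z / z)"
      unfolding diff_eq by (rule contour_integral_diff[OF cG(2) cS(2), symmetric])
    finally have "2 * pi * \<i> * (G 0 - S (Suc N) 0) =
        contour_integral \<gamma> (\<lambda>z. (G z - S (Suc N) z) * K N z / z)
        + contour_integral p (\<lambda>z. G z * K N z / z) - contour_integral \<eta> (\<lambda>z. S (Suc N) z * K N z / z)" .
    hence "norm (2 * pi * \<i> * (G 0 - S (Suc N) 0)) \<le>
        norm (contour_integral \<gamma> (\<lambda>z. (G z - S (Suc N) z) * K N z / z))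
        + norm (contour_integral p (\<lambda>z. G z * K N z / z)) + norm (contour_integral \<eta> (\<lambda>z. S (Suc N) z * K N z / z))"
      by (simp only:) (intro order_trans[OF norm_triangle_ineq4] add_mono norm_triangle_ineq order_refl)
    \<comment> \<open>Both arcs have length pi R, so after division by 2 pi each main bound
      \<open>2 / R\<^sup>2\<close> contributes 1 / R.\<close>
    moreover have "norm (contour_integral \<gamma> (\<lambda>z. (G z - S (Suc N) z) * K N z / z)) \<le> 2 / R\<^sup>2 * R * \<bar>pi/2 - (-(pi/2))\<bar>"
      unfolding \<gamma>_def
    proof (rule contour_integral_bound_part_circlepath)
      show "(\<lambda>z. (G z - S (Suc N) z) * K N z / z) contour_integrable_on part_circlepath 0 R (- (pi / 2)) (pi / 2)"
        unfolding diff_eq \<gamma>_def[symmetric] by (rule contour_integrable_diff[OF cG(2) cS(2)])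
    qed (use R bound1 in \<open>auto simp: \<gamma>_def\<close>)
    moreover have "norm (contour_integral \<eta> (\<lambda>z. S (Suc N) z * K N z / z)) \<le> (2 / R\<^sup>2 + 2 / (R * Suc N)) * R * \<bar>3*pi/2 - pi/2\<bar>"
      unfolding \<eta>_def
      by (rule contour_integral_bound_part_circlepath) (use R bound2 cS(3) in \<open>auto simp: \<eta>_def\<close>)
    moreover have "norm (2 * pi * \<i> * (G 0 - S (Suc N) 0)) = 2 * pi * norm (G 0 - S (Suc N) 0)"
      by (simp add: norm_mult)
    moreover have "2 / R\<^sup>2 * R * \<bar>pi/2 - (-(pi/2))\<bar> = 2 * pi * (1 / R)"
      using R by (simp add: power2_eq_square field_simps)
    moreover have "(2 / R\<^sup>2 + 2 / (R * Suc N)) * R * \<bar>3*pi/2 - pi/2\<bar> = 2 * pi * (1 / R + 1 / Suc N)"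
    proof -
      have "(2 / R\<^sup>2 + 2 / (R * m)) * R * \<bar>3*pi/2 - pi/2\<bar> = 2 * pi * (1 / R + 1 / m)" if "m > 0" for m :: real
        using R that by (simp add: power2_eq_square field_simps)
      from this[of "Suc N"] show ?thesis by simp
    qed
    ultimately have "2 * pi * norm (G 0 - S (Suc N) 0) \<le> 2 * pi * (1 / R) + norm (contour_integral p (\<lambda>z. G z * K N z / z)) + 2 * pi * (1 / R + 1 / Suc N)"
      by linarith
    moreover have "x \<le> 2 / R + (k + y / (2 * pi))"
      if "2 * pi * x \<le> 2 * pi * (1 / R) + y + 2 * pi * (1 / R + k)" for x y k :: real
    proof -
      have "x * (2 * pi) \<le> (2 / R + (k + y / (2 * pi))) * (2 * pi)"
        using that by (simp add: algebra_simps)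
      thus ?thesis by (rule mult_right_le_imp_le) simp
    qed
    ultimately show "norm (G 0 - S (Suc N) 0) \<le> 2 / R + b N"
      unfolding b_def by blast
  qed
qed

text \<open>For fixed R the error is eventually below any number exceeding 2 / R, and R is
  free.\<close>

theorem newman_tauberian:
  fixes a :: "nat \<Rightarrow> complex"
  assumes a: "\<And>n. norm (a n) \<le> 1"
    and U: "open U" "{z. Re z \<ge> 0} \<subseteq> U" and G: "G holomorphic_on U"
    and sums: "\<And>z. Re z > 0 \<Longrightarrow> (\<lambda>n. a n * of_nat (Suc n) powr (-1 - z)) sums G z"
  shows "(\<lambda>n. a n / of_nat (Suc n)) sums G 0"
proof -
  define S where "S = (\<lambda>N. \<Sum>n<N. a n * of_nat (Suc n) powr (-1 - 0))"
  have "(\<lambda>N. S (Suc N)) \<longlonglongrightarrow> G 0"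
  proof (rule LIMSEQ_I)
    fix r :: real assume r: "r > 0"
    define R where "R = 4 / r"
    have R: "R > 0" "2 / R = r / 2" using r by (auto simp: R_def)
    obtain b where b: "b \<longlonglongrightarrow> 0" "\<And>N. norm (G 0 - S (Suc N)) \<le> 2 / R + b N"
      using newman_estimate[OF a U G sums R(1)] unfolding S_def by blast
    have "\<forall>\<^sub>F N in sequentially. b N < r / 2"
      using r by (intro order_tendstoD[OF b(1)]) auto
    hence "\<forall>\<^sub>F N in sequentially. norm (S (Suc N) - G 0) < r"
    proof eventually_elim
      case (elim N)
      thus ?case using b(2)[of N] R by (simp add: norm_minus_commute)
    qed
    thus "\<exists>no. \<forall>N\<ge>no. norm (S (Suc N) - G 0) < r" by (simp add: eventually_sequentially)
  qed
  hence "S \<longlonglongrightarrow> G 0" by (simp add: filterlim_sequentially_Suc)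
  moreover have "a n * of_nat (Suc n) powr (-1 - 0) = a n / of_nat (Suc n)" for n
    using powr_minus[of "of_nat (Suc n) :: complex" 1] by (simp add: field_simps del: of_nat_Suc)
  ultimately show ?thesis by (simp add: sums_def S_def del: of_nat_Suc)
qed

section \<open>Euler products and the character modulo 4\<close>

text \<open>One prime q is removed at a time. Among the numbers prime to A, the multiples of q are
  exactly q times such numbers, because no prime of A divides q; by multiplicativity their sum is
  \<open>f q\<close> times the whole.\<close>

lemma infsum_sieve:
  fixes f :: "nat \<Rightarrow> complex"
  assumes mult: "\<And>m n. f (m * n) = f m * f n" and f: "f summable_on UNIV"
    and A: "finite A" "\<And>p. p \<in> A \<Longrightarrow> prime p"
  shows "infsum f {n. \<forall>p\<in>A. \<not> p dvd n} = (\<Prod>p\<in>A. 1 - f p) * infsum f UNIV"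
  using A
proof (induction A rule: finite_induct)
  case (insert q A)
  define T where "T = {n. \<forall>p\<in>A. \<not> p dvd n}"
  define T' where "T' = {n. \<forall>p\<in>insert q A. \<not> p dvd n}"
  have q: "prime q" and A: "\<And>p. p \<in> A \<Longrightarrow> prime p" using insert.prems by auto
  have T: "T = T' \<union> (\<lambda>m. q * m) ` T"
  proof (intro equalityI subsetI)
    fix n assume n: "n \<in> T"
    show "n \<in> T' \<union> (\<lambda>m. q * m) ` T"
    proof (cases "q dvd n")
      case True
      then obtain m where m: "n = q * m" by auto
      with n have "m \<in> T" by (auto simp: T_def)
      with m show ?thesis by blast
    qed (use n in \<open>auto simp: T_def T'_def\<close>)
  next
    fix n assume "n \<in> T' \<union> (\<lambda>m. q * m) ` T"
    moreover have "\<not> p dvd q * m" if "p \<in> A" "m \<in> T" for p m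
      using that A[OF that(1)] q insert.hyps primes_dvd_imp_eq[of p q]
      by (auto simp: T_def prime_dvd_mult_iff)
    ultimately show "n \<in> T" by (auto simp: T_def T'_def)
  qed
  have disj: "T' \<inter> (\<lambda>m. q * m) ` T = {}" by (auto simp: T'_def)
  have sm: "f summable_on X" for X by (rule summable_on_subset_banach[OF f]) auto
  have "infsum f T = infsum f T' + infsum f ((\<lambda>m. q * m) ` T)"
    by (subst T) (intro infsum_Un_disjoint sm disj)
  also have "infsum f ((\<lambda>m. q * m) ` T) = infsum (f \<circ> (\<lambda>m. q * m)) T"
    using q by (intro infsum_reindex) (auto simp: inj_on_def)
  also have "\<dots> = f q * infsum f T"
    unfolding o_def mult by (rule infsum_cmult_right) (rule sm)
  finally have "infsum f T' = infsum f T - f q * infsum f T" by (rule eq_diff_eq[THEN iffD2, OF sym])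
  hence "infsum f T' = (1 - f q) * infsum f T" by (simp only: left_diff_distrib mult_1)
  with insert show ?case by (simp add: T_def T'_def)
qed simp

text \<open>After sieving by all primes up to N, only 1 and numbers above N remain, so the sieved
  sum differs from \<open>f 1 = 1\<close> by at most a tail of the absolutely convergent
  series.\<close>

lemma euler_product:
  fixes f :: "nat \<Rightarrow> complex"
  assumes mult: "\<And>m n. f (m * n) = f m * f n" and f0: "f 0 = 0" and f1: "f 1 = 1"
    and f: "summable (\<lambda>n. norm (f n))"
  shows "(\<lambda>N. (\<Prod>p | prime p \<and> p \<le> N. 1 - f p) * suminf f) \<longlonglongrightarrow> 1"
proof -
  define g where "g = (\<lambda>n. norm (f n))"
  define T where "T = (\<lambda>N. {n. \<forall>p\<in>{p. prime p \<and> p \<le> N}. \<not> p dvd (n::nat)})"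
  have sf: "f summable_on UNIV" using f by (rule norm_summable_imp_summable_on)
  have sg: "g summable_on UNIV" unfolding g_def by (rule norm_summable_imp_summable_on) (use f in simp)
  have "suminf f = infsum f UNIV"
    using norm_summable_imp_has_sum[OF f summable_sums[OF summable_norm_cancel[OF f]]] by (simp add: infsumI)
  hence eq: "(\<Prod>p | prime p \<and> p \<le> N. 1 - f p) * suminf f = infsum f (T N)" for N
    unfolding T_def by (subst infsum_sieve[OF mult sf]) auto
  have g_sums: "g sums infsum g UNIV"
    using has_sum_imp_sums[OF has_sum_infsum[OF sg]] by simp
  \<comment> \<open>N at least 2 ensures that the prime 2 has been sieved, which removes 0 from the
    set.\<close>
  have bound: "norm (infsum f (T N) - 1) \<le> infsum g UNIV - sum g {..<Suc N}" if N: "N \<ge> 2" for N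
  proof -
    define T' where "T' = T N - {1}"
    have T: "T N = {1} \<union> T'" unfolding T'_def T_def by (auto dest: prime_gt_1_nat)
    have sub: "T' \<subseteq> UNIV - {..<Suc N}"
    proof
      fix n assume n: "n \<in> T'"
      hence "n \<noteq> 1" by (simp add: T'_def)
      have "n \<noteq> 0" using n N two_is_prime_nat by (cases n) (fastforce simp: T'_def T_def)+
      obtain p where "prime p" "p dvd n" using prime_factor_nat[OF \<open>n \<noteq> 1\<close>] by blast
      moreover from this \<open>n \<noteq> 0\<close> have "p \<le> n" by (auto dest: dvd_imp_le)
      ultimately show "n \<in> UNIV - {..<Suc N}" using n by (auto simp: T'_def T_def)
    qed
    have sm: "f summable_on X" "g summable_on X" for X
      using summable_on_subset_banach[OF sf] summable_on_subset_banach[OF sg] by auto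
    have "infsum f (T N) = infsum f {1} + infsum f T'"
      by (subst T) (intro infsum_Un_disjoint sm, auto simp: T'_def)
    hence "norm (infsum f (T N) - 1) = norm (infsum f T')" using f1 by simp
    also have "\<dots> \<le> infsum g T'"
      unfolding g_def by (rule norm_infsum_bound) (use sm(2)[of T'] in \<open>simp add: g_def\<close>)
    also have "\<dots> \<le> infsum g (UNIV - {..<Suc N})"
      by (rule infsum_mono2[OF sm(2) sm(2) sub]) (auto simp: g_def)
    also have "\<dots> = infsum g UNIV - infsum g {..<Suc N}"
      by (intro infsum_Diff sm) auto
    finally show ?thesis by simp
  qed
  have "(\<lambda>N. infsum g UNIV - sum g {..<Suc N}) \<longlonglongrightarrow> infsum g UNIV - infsum g UNIV"
    using tendsto_diff[OF tendsto_const[of "infsum g UNIV"] LIMSEQ_Suc[OF g_sums[unfolded sums_def]]] .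
  hence lim: "(\<lambda>N. infsum g UNIV - sum g {..<Suc N}) \<longlonglongrightarrow> 0" by simp
  have "(\<lambda>N. norm (infsum f (T N) - 1)) \<longlonglongrightarrow> 0"
  proof (rule tendsto_sandwich[OF _ _ tendsto_const lim])
    show "\<forall>\<^sub>F N in sequentially. norm (infsum f (T N) - 1) \<le> infsum g UNIV - sum g {..<Suc N}"
      by (rule eventually_mono[OF eventually_ge_at_top[of 2] bound])
  qed auto
  hence "(\<lambda>N. infsum f (T N)) \<longlonglongrightarrow> 1"
    by (rule LIM_zero_cancel[OF tendsto_norm_zero_cancel])
  thus ?thesis by (simp only: eq)
qed

section \<open>The character modulo 4 and the complete multiplicativity of \<alpha>\<close>

definition chi4 :: "nat \<Rightarrow> int" where
  "chi4 n = (if n mod 4 = 1 then 1 else if n mod 4 = 3 then -1 else 0)"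

lemma chi4_mult: "chi4 (m * n) = chi4 m * chi4 n"
proof -
  have small: "chi4 (a * b) = chi4 a * chi4 b" if "a \<in> {0,1,2,3}" "b \<in> {0,1,2,3}" for a b
    using that by (elim insertE emptyE; simp add: chi4_def)
  have mod4: "chi4 (k mod 4) = chi4 k" for k by (simp add: chi4_def)
  have "chi4 (m * n) = chi4 ((m mod 4) * (n mod 4))" by (simp add: chi4_def mod_mult_eq)
  also have "\<dots> = chi4 (m mod 4) * chi4 (n mod 4)" by (rule small) auto
  finally show ?thesis by (simp only: mod4)
qed

lemma chi4_1 [simp]: "chi4 1 = 1" "chi4 (Suc 0) = 1"
  by (auto simp: chi4_def)

lemma abs_chi4_le: "\<bar>chi4 n\<bar> \<le> 1"
  by (auto simp: chi4_def)

lemma chi4_cases: "chi4 n = 0 \<or> chi4 n = 1 \<or> chi4 n = -1"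
  by (auto simp: chi4_def)

lemma chi4_even: "even n \<Longrightarrow> chi4 n = 0"
  unfolding chi4_def by presburger

lemma chi4_odd:
  assumes "odd n"
  shows "chi4 n = (-1) ^ ((n - 1) div 2)"
proof -
  have "n mod 4 = 1 \<and> even ((n - 1) div 2) \<or> n mod 4 = 3 \<and> odd ((n - 1) div 2)"
    using assms by presburger
  thus ?thesis by (auto simp: chi4_def)
qed

lemma chi4_power: "chi4 (n ^ k) = chi4 n ^ k"
  by (induction k) (auto simp: chi4_mult)

text \<open>For an odd prime power the sign \<open>(-1) ^ ((p ^ r - 1) div 2)\<close> is
  \<open>chi4 (p ^ r) = chi4 p ^ r\<close>. Hence each factor of \<alpha> is the r-th power of
  \<open>- chi4 p\<close>, although its definition by prime powers does not look completely
  multiplicative.\<close>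

lemma alpha_eq_prod_mset:
  assumes "odd n"
  shows "alpha n = prod_mset (image_mset (\<lambda>p. - chi4 p) (prime_factorization n))"
proof -
  have "prod_mset (image_mset (\<lambda>p. - chi4 p) (prime_factorization n)) =
        (\<Prod>p\<in>prime_factors n. (- chi4 p) ^ multiplicity p n)"
    by (simp add: image_prod_mset_multiplicity count_prime_factorization_prime in_prime_factors_imp_prime cong: prod.cong)
  also have "\<dots> = alpha n"
    unfolding alpha_def
  proof (rule prod.cong)
    fix p assume p: "p \<in> prime_factors n"
    have "odd (p ^ multiplicity p n)"
      using assms multiplicity_dvd[of p n] dvd_trans by blast
    hence "chi4 p ^ multiplicity p n = (-1) ^ ((p ^ multiplicity p n - 1) div 2)"
      by (subst chi4_power[symmetric]) (rule chi4_odd)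
    thus "(- chi4 p) ^ multiplicity p n =
          (- 1) ^ multiplicity p n * (- 1) ^ ((p ^ multiplicity p n - 1) div 2)"
      by (simp only: power_minus[of "chi4 p"])
  qed simp
  finally show ?thesis ..
qed

text \<open>
  Extending \<^const>\<open>alpha\<close> by \<open>0\<close> to even arguments makes it completely multiplicative; on odd
  arguments it is the product of \<^const>\<open>chi4\<close> and the Liouville function.
\<close>

definition alpha0 :: "nat \<Rightarrow> int" where
  "alpha0 n = (if odd n then alpha n else 0)"

lemma alpha0_mult: "alpha0 (m * n) = alpha0 m * alpha0 n"
proof (cases "odd m \<and> odd n")
  case True
  hence "m \<noteq> 0" "n \<noteq> 0" by (auto elim: oddE)
  with True show ?thesis
    by (simp add: alpha0_def alpha_eq_prod_mset prime_factorization_mult)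
qed (auto simp: alpha0_def)

lemma alpha0_1: "alpha0 1 = 1"
  by (simp add: alpha0_def alpha_def)

lemma alpha0_prime:
  assumes "prime p"
  shows "alpha0 p = - chi4 p"
  using assms by (cases "odd p") (simp_all add: alpha0_def alpha_eq_prod_mset prime_factorization_prime chi4_even)

lemma abs_alpha0_le: "\<bar>alpha0 n\<bar> \<le> 1"
proof (cases "odd n")
  case True
  have "\<bar>prod_mset (image_mset (\<lambda>p. - chi4 p) M)\<bar> \<le> 1" for M
    by (induction M) (use abs_chi4_le in \<open>auto simp: abs_mult intro: mult_le_one\<close>)
  with True show ?thesis by (simp add: alpha0_def alpha_eq_prod_mset)
qed (auto simp: alpha0_def)

text \<open>The term with index \<open>0\<close> vanishes because \<open>0 powr _ = 0\<close>.\<close>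

definition dseries :: "(nat \<Rightarrow> int) \<Rightarrow> complex \<Rightarrow> complex" where
  "dseries c s = (\<Sum>n. of_int (c n) * of_nat n powr (- s))"

lemma norm_dseries_term_le:
  assumes "\<And>n. \<bar>c n\<bar> \<le> (1::int)"
  shows "norm (of_int (c n) * of_nat n powr (- s) :: complex) \<le> real n powr (- Re s)"
proof -
  have "norm (of_int (c n) :: complex) \<le> 1" using assms[of n] by (simp flip: of_int_abs)
  thus ?thesis unfolding norm_mult norm_of_nat_powr by (simp add: mult_left_le_one_le)
qed

lemma summable_norm_dseries:
  assumes "\<And>n. \<bar>c n\<bar> \<le> (1::int)" and "Re s > 1"
  shows "summable (\<lambda>n. norm (of_int (c n) * of_nat n powr (- s) :: complex))"
proof (rule summable_comparison_test')
  show "summable (\<lambda>n. real n powr (- Re s))" using assms(2) by (simp add: summable_real_powr_iff)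
  show "norm (norm (of_int (c n) * of_nat n powr (- s) :: complex)) \<le> real n powr (- Re s)" for n
    using norm_dseries_term_le[OF assms(1)] by simp
qed

lemma of_nat_mult_powr: "of_nat (m * n) powr s = of_nat m powr s * (of_nat n powr s :: complex)"
  unfolding of_nat_mult by (rule powr_times_real_left) auto

lemma dseries_euler_product:
  assumes mult: "\<And>m n. c (m * n) = c m * c n" and c1: "c 1 = 1"
    and bound: "\<And>n. \<bar>c n\<bar> \<le> (1::int)" and s: "Re s > 1"
  shows "(\<lambda>N. (\<Prod>p | prime p \<and> p \<le> N. 1 - of_int (c p) * of_nat p powr (- s)) * dseries c s) \<longlonglongrightarrow> 1"
  unfolding dseries_def
proof (rule euler_product)
  show "summable (\<lambda>n. norm (of_int (c n) * of_nat n powr (- s) :: complex))"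
    using bound s by (rule summable_norm_dseries)
  show "of_int (c (m * n)) * of_nat (m * n) powr (- s) =
      of_int (c m) * of_nat m powr (- s) * (of_int (c n) * of_nat n powr (- s) :: complex)" for m n
    unfolding mult of_nat_mult_powr by simp
qed (use c1 in auto)

text \<open>If the series were 0, the sequence in the Euler product would be constantly 0 and could
  not tend to 1.\<close>

lemma dseries_nonzero:
  assumes "\<And>m n. c (m * n) = c m * c n" "c 1 = 1" "\<And>n. \<bar>c n\<bar> \<le> (1::int)" "Re s > 1"
  shows "dseries c s \<noteq> 0"
  using dseries_euler_product[OF assms] LIMSEQ_unique[OF _ tendsto_const] by force

text \<open>Since \<open>alpha0 p = - chi4 p\<close>, the two local factors are conjugate, (1 + u)(1
  - u) = 1 - u^2 with \<open>u = chi4 p * p powr (- s)\<close>.\<close>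

lemma dseries_alpha0_chi4:
  assumes s: "Re s > 1"
  shows "dseries alpha0 s * dseries chi4 s = dseries (\<lambda>n. chi4 n ^ 2) (2 * s)"
proof -
  define P where "P = (\<lambda>c N s. \<Prod>p | prime p \<and> p \<le> N. 1 - of_int (c p :: int) * of_nat p powr (- s) :: complex)"
  have chi2: "\<bar>chi4 n ^ 2\<bar> \<le> 1" for n using chi4_cases[of n] by auto
  have s2: "Re (2 * s) > 1" using s by simp
  note lims = dseries_euler_product[OF alpha0_mult alpha0_1 abs_alpha0_le s]
    dseries_euler_product[OF chi4_mult chi4_1(1) abs_chi4_le s]
  have eq: "P alpha0 N s * P chi4 N s = P (\<lambda>n. chi4 n ^ 2) N (2 * s)" for N
    unfolding P_def prod.distrib[symmetric]
  proof (rule prod.cong)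
    fix p assume "p \<in> {p. prime p \<and> p \<le> N}"
    hence "alpha0 p = - chi4 p" by (simp add: alpha0_prime)
    moreover have "of_nat p powr (- (2 * s)) = (of_nat p powr (- s) :: complex)\<^sup>2"
      by (simp add: power2_eq_square flip: powr_add)
    ultimately show "(1 - of_int (alpha0 p) * of_nat p powr (- s)) * (1 - of_int (chi4 p) * of_nat p powr (- s)) =
        1 - of_int (chi4 p ^ 2) * (of_nat p powr (- (2 * s)) :: complex)"
      by (simp add: algebra_simps power2_eq_square)
  qed simp
  define A B D where "A = dseries alpha0 s" "B = dseries chi4 s" "D = dseries (\<lambda>n. chi4 n ^ 2) (2 * s)"
  have 1: "(\<lambda>N. P (\<lambda>n. chi4 n ^ 2) N (2 * s) * D) \<longlonglongrightarrow> 1"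
    unfolding A_B_D_def P_def
    by (rule dseries_euler_product[where c = "\<lambda>n. chi4 n ^ 2"])
       (use chi2 s2 in \<open>simp_all add: chi4_mult power_mult_distrib\<close>)
  have "(\<lambda>N. (P alpha0 N s * A) * (P chi4 N s * B)) \<longlonglongrightarrow> 1 * 1"
    using tendsto_mult[OF lims(1,2)] unfolding A_B_D_def P_def .
  hence "(\<lambda>N. (P alpha0 N s * P chi4 N s) * (A * B)) \<longlonglongrightarrow> 1" by (simp add: mult_ac)
  hence "(\<lambda>N. P (\<lambda>n. chi4 n ^ 2) N (2 * s) * (A * B)) \<longlonglongrightarrow> 1" by (simp only: eq)
  \<comment> \<open>The same finite products, multiplied by D and by A * B, both tend to 1.
    Computing the limit of the product times A * B * D in two ways gives D = A * B without any
    division.\<close>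
  from tendsto_mult[OF this tendsto_const[of D]]
  have "(\<lambda>N. (P (\<lambda>n. chi4 n ^ 2) N (2 * s) * D) * (A * B)) \<longlonglongrightarrow> D" by (simp add: mult_ac)
  moreover have "(\<lambda>N. (P (\<lambda>n. chi4 n ^ 2) N (2 * s) * D) * (A * B)) \<longlonglongrightarrow> 1 * (A * B)"
    by (rule tendsto_mult[OF 1 tendsto_const])
  ultimately have "D = 1 * (A * B)" by (rule LIMSEQ_unique)
  thus ?thesis by (simp add: A_B_D_def)
qed

section \<open>The 3-4-1 inequality\<close>

text \<open>Expanding the logarithms, the coefficient of - r^n / n is 3 + 4 cos x + cos 2x = 2 (1 +
  cos x)^2 with cos x = Re (z^n), which is nonnegative.\<close>

lemma norm_one_minus_3_4_1:
  fixes z :: complex and r :: real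
  assumes r: "0 < r" "r < 1" and z: "norm z = 1"
  shows "norm (1 - of_real r :: complex) ^ 3 * norm (1 - r * z) ^ 4 * norm (1 - r * z\<^sup>2) \<le> 1"
proof -
  \<comment> \<open>The term n = 0 is a division by 0 and therefore 0, so the logarithm series may
    be indexed from 0.\<close>
  have sums: "(\<lambda>n. - (r ^ n * Re (u ^ n) / n)) sums ln (norm (1 - r * u))" if u: "norm u = 1" for u :: complex
  proof -
    have lt: "norm (- (r * u)) < 1" using r u by (simp add: norm_mult)
    hence "- (r * u) \<noteq> -1" by (metis less_irrefl norm_minus_cancel norm_one)
    hence ne: "1 + - (r * u) \<noteq> 0" by (simp add: add_eq_0_iff2)
    have "(\<lambda>n. Re (- ((- (- (r * u))) ^ n) / of_nat n)) sums Re (ln (1 + - (r * u)))"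
      by (rule sums_Re[OF Ln_series'[OF lt]])
    also have "(\<lambda>n. Re (- ((- (- (r * u))) ^ n) / of_nat n)) = (\<lambda>n. - (r ^ n * Re (u ^ n) / n))"
      by (simp add: power_mult_distrib Re_divide_of_nat flip: of_real_power)
    also have "Re (ln (1 + - (r * u))) = ln (norm (1 - r * u))" using ne by simp
    finally show ?thesis .
  qed
  have pos: "norm (1 - r * u) > 0" if "norm u = 1" for u :: complex
  proof -
    have "norm (r * u) < norm (1 :: complex)" using r that by (simp add: norm_mult)
    hence "1 - r * u \<noteq> 0" by (metis eq_iff_diff_eq_0 less_irrefl)
    thus ?thesis by simp
  qed
  have z2: "norm (z\<^sup>2) = 1" using z by (simp add: norm_power)
  have S: "(\<lambda>n. 3 * - (r ^ n * Re (1 ^ n) / n) + 4 * - (r ^ n * Re (z ^ n) / n) + - (r ^ n * Re ((z\<^sup>2) ^ n) / n)) sums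
     (3 * ln (norm (1 - r * (1::complex))) + 4 * ln (norm (1 - r * z)) + ln (norm (1 - r * z\<^sup>2)))"
    by (rule sums_add[OF sums_add[OF sums_mult[OF sums[OF norm_one]] sums_mult[OF sums[OF z]]] sums[OF z2]])
  have le: "3 * - (r ^ n * Re (1 ^ n) / n) + 4 * - (r ^ n * Re (z ^ n) / n) + - (r ^ n * Re ((z\<^sup>2) ^ n) / n) \<le> 0" for n
  proof -
    have "norm (z ^ n) = 1" using z by (simp add: norm_power)
    hence "(Re (z ^ n))\<^sup>2 + (Im (z ^ n))\<^sup>2 = 1" by (simp add: cmod_def)
    moreover have "(z\<^sup>2) ^ n = (z ^ n)\<^sup>2" by (simp add: power_mult[symmetric] mult.commute)
    hence "Re ((z\<^sup>2) ^ n) = (Re (z ^ n))\<^sup>2 - (Im (z ^ n))\<^sup>2" by (simp only: Re_power2)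
    ultimately have Re2: "Re ((z\<^sup>2) ^ n) = 2 * (Re (z ^ n))\<^sup>2 - 1" by simp
    have "3 * - (r ^ n * Re (1 ^ n) / n) + 4 * - (r ^ n * Re (z ^ n) / n) + - (r ^ n * Re ((z\<^sup>2) ^ n) / n)
       = - (r ^ n / n * (2 * (1 + Re (z ^ n))\<^sup>2))"
      unfolding Re2 by (cases "n = 0") (simp_all add: field_simps power2_eq_square)
    also have "\<dots> \<le> 0" using r by (intro neg_le_0_iff_le[THEN iffD2] mult_nonneg_nonneg) auto
    finally show ?thesis .
  qed
  have "3 * ln (norm (1 - r * (1::complex))) + 4 * ln (norm (1 - r * z)) + ln (norm (1 - r * z\<^sup>2)) \<le> 0"
    by (rule sums_le[OF le S sums_zero])
  hence "ln (norm (1 - of_real r :: complex) ^ 3 * norm (1 - r * z) ^ 4 * norm (1 - r * z\<^sup>2)) \<le> 0"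
    using pos[of 1] pos[OF z] pos[OF z2] by (simp add: ln_mult_pos ln_realpow)
  moreover have "norm (1 - of_real r :: complex) ^ 3 * norm (1 - r * z) ^ 4 * norm (1 - r * z\<^sup>2) > 0"
    using pos[of 1] pos[OF z] pos[OF z2] by (intro mult_pos_pos zero_less_power) auto
  ultimately show ?thesis by (simp only: ln_le_zero_iff)
qed

text \<open>The local factors appear inverted: their combined norm is at most 1 at every prime,
  while each product times its series tends to 1. This forces the combination of the series to be at
  least 1.\<close>

lemma mertens_inequality:
  assumes \<sigma>: "\<sigma> > (1::real)"
  shows "norm (dseries (\<lambda>_. 1) \<sigma>) ^ 3 * norm (dseries chi4 (Complex \<sigma> t)) ^ 4 * norm (dseries (\<lambda>_. 1) (Complex \<sigma> (2 * t))) \<ge> 1"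
proof -
  define P where "P = (\<lambda>c N s. \<Prod>p | prime p \<and> p \<le> N. 1 - of_int (c p :: int) * of_nat p powr (- s) :: complex)"
  define s1 s2 s3 where "s1 = complex_of_real \<sigma>" "s2 = Complex \<sigma> t" "s3 = Complex \<sigma> (2 * t)"
  have re: "Re s1 > 1" "Re s2 > 1" "Re s3 > 1" using \<sigma> by (simp_all add: s1_s2_s3_def)
  define A B D where "A = dseries (\<lambda>_. 1) s1" "B = dseries chi4 s2" "D = dseries (\<lambda>_. 1) s3"
  have lims: "(\<lambda>N. P (\<lambda>_. 1) N s1 * A) \<longlonglongrightarrow> 1" "(\<lambda>N. P chi4 N s2 * B) \<longlonglongrightarrow> 1" "(\<lambda>N. P (\<lambda>_. 1) N s3 * D) \<longlonglongrightarrow> 1"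
    unfolding A_B_D_def P_def using re
    by (auto intro!: dseries_euler_product[of "\<lambda>_. 1", simplified] dseries_euler_product[OF chi4_mult chi4_1(1) abs_chi4_le])
  have le: "norm (P (\<lambda>_. 1) N s1) ^ 3 * norm (P chi4 N s2) ^ 4 * norm (P (\<lambda>_. 1) N s3) \<le> 1" for N
    unfolding P_def prod_norm[symmetric] prod_power_distrib prod.distrib[symmetric]
  proof (rule prod_le_1)
    fix p assume "p \<in> {p. prime p \<and> p \<le> N}"
    hence p: "p > 1" by (auto dest: prime_gt_1_nat)
    define r where "r = real p powr (- \<sigma>)"
    define w where "w = (of_nat p powr (- (\<i> * t)) :: complex)"
    have r: "0 < r" "r < 1" using p \<sigma> by (auto simp: r_def powr_less_one)
    have w: "norm w = 1" using p unfolding w_def norm_of_nat_powr by simp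
    have e1: "of_nat p powr (- s1) = complex_of_real r"
      unfolding s1_s2_s3_def r_def using powr_of_real[of "real p" "-\<sigma>"] by simp
    have "- s2 = - s1 + - (\<i> * t)" "- s3 = - s1 + (- (\<i> * t) + - (\<i> * t))"
      by (simp_all add: s1_s2_s3_def complex_eq_iff)
    hence e2: "of_nat p powr (- s2) = r * w" and e3: "of_nat p powr (- s3) = r * w\<^sup>2"
      by (simp_all only: powr_add e1 w_def power2_eq_square)
    have "norm (1 - complex_of_real r) ^ 3 * norm (1 - of_int (chi4 p) * (r * w)) ^ 4 * norm (1 - r * w\<^sup>2) \<le> 1"
    proof (cases "chi4 p = 0")
      \<comment> \<open>This is the prime 2, where the factor of \<open>chi4\<close> is trivial and
        the 3-4-1 identity does not apply; (1 - r)^3 (1 + r) is at most 1 directly.\<close>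
      case True
      have "norm (1 - complex_of_real r) = 1 - r"
        using r norm_of_real[of "1 - r", where 'a = complex] by simp
      moreover have "norm (1 - r * w\<^sup>2) \<le> 1 + r"
        using norm_triangle_ineq4[of 1 "r * w\<^sup>2"] r w by (simp add: norm_mult norm_power)
      ultimately have "norm (1 - complex_of_real r) ^ 3 * norm (1 - r * w\<^sup>2) \<le> (1 - r) ^ 3 * (1 + r)"
        using r by (simp add: mult_left_mono)
      also have "\<dots> = (1 - r)\<^sup>2 * (1 - r\<^sup>2)" by (simp add: power2_eq_square power3_eq_cube algebra_simps)
      also have "\<dots> \<le> 1 * 1" using r by (intro mult_mono power_le_one) (auto simp: power_le_one)
      finally show ?thesis using True by simp
    next
      case False
      hence chi: "chi4 p = 1 \<or> chi4 p = -1" using chi4_cases by blast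
      hence "(of_int (chi4 p) * w)\<^sup>2 = w\<^sup>2" "norm (of_int (chi4 p) * w) = 1" using w by auto
      moreover have "of_int (chi4 p) * (r * w) = r * (of_int (chi4 p) * w)" by simp
      ultimately show ?thesis using norm_one_minus_3_4_1[OF r, of "of_int (chi4 p) * w"] by (simp only:)
    qed
    thus "0 \<le> norm (1 - of_int 1 * (of_nat p powr (- s1) :: complex)) ^ 3 * norm (1 - of_int (chi4 p) * (of_nat p powr (- s2) :: complex)) ^ 4
          * norm (1 - of_int 1 * (of_nat p powr (- s3) :: complex)) \<and>
        norm (1 - of_int 1 * (of_nat p powr (- s1) :: complex)) ^ 3 * norm (1 - of_int (chi4 p) * (of_nat p powr (- s2) :: complex)) ^ 4
          * norm (1 - of_int 1 * (of_nat p powr (- s3) :: complex)) \<le> 1"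
      unfolding e1 e2 e3 by simp
  qed
  have lim: "(\<lambda>N. norm (P (\<lambda>_. 1) N s1 * A) ^ 3 * norm (P chi4 N s2 * B) ^ 4 * norm (P (\<lambda>_. 1) N s3 * D))
      \<longlonglongrightarrow> norm (1::complex) ^ 3 * norm (1::complex) ^ 4 * norm (1::complex)"
    by (intro tendsto_mult tendsto_power tendsto_norm lims)
  have bnd: "norm (P (\<lambda>_. 1) N s1 * A) ^ 3 * norm (P chi4 N s2 * B) ^ 4 * norm (P (\<lambda>_. 1) N s3 * D)
      \<le> norm A ^ 3 * norm B ^ 4 * norm D" for N
  proof -
    have "(norm (P (\<lambda>_. 1) N s1) ^ 3 * norm (P chi4 N s2) ^ 4 * norm (P (\<lambda>_. 1) N s3)) * (norm A ^ 3 * norm B ^ 4 * norm D)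
        \<le> 1 * (norm A ^ 3 * norm B ^ 4 * norm D)"
      by (rule mult_right_mono[OF le]) simp
    thus ?thesis by (simp add: norm_mult power_mult_distrib mult_ac)
  qed
  have "norm (1::complex) ^ 3 * norm (1::complex) ^ 4 * norm (1::complex) \<le> norm A ^ 3 * norm B ^ 4 * norm D"
    using bnd by (intro LIMSEQ_le_const2[OF lim]) blast
  thus ?thesis by (simp add: A_B_D_def s1_s2_s3_def)
qed

section \<open>An upper bound for zeta and the holomorphy of Dirichlet series\<close>

lemma norm_powr_diff_le:
  fixes s :: complex and m u v :: real
  assumes m: "0 < m" "m \<le> u" "m \<le> v" and s: "Re s \<ge> 0"
  shows "norm (of_real u powr (- s) - of_real v powr (- s)) \<le> norm s * m powr (- Re s - 1) * \<bar>u - v\<bar>"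
proof -
  define S where "S = closed_segment (complex_of_real u) (of_real v)"
  have S: "\<exists>x. z = of_real x \<and> x \<ge> m" if "z \<in> S" for z
    using that m by (auto simp: S_def closed_segment_of_real closed_segment_eq_real_ivl split: if_splits)
  have "norm (complex_of_real u powr (- s) - of_real v powr (- s)) \<le> (norm s * m powr (- Re s - 1)) * norm (complex_of_real u - of_real v)"
  proof (rule field_differentiable_bound[of S "\<lambda>z. z powr (- s)" "\<lambda>z. - s * z powr (- s - 1)"])
    fix z assume "z \<in> S"
    then obtain x where x: "z = of_real x" "x \<ge> m" using S by blast
    hence "z \<notin> \<real>\<^sub>\<le>\<^sub>0" using m by auto
    thus "((\<lambda>z. z powr (- s)) has_field_derivative - s * z powr (- s - 1)) (at z within S)"
      by (rule has_field_derivative_at_within[OF has_field_derivative_powr])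
    have "norm (z powr (- s - 1)) = x powr (- Re s - 1)" 
      using x m by (simp add: norm_powr_real_powr)
    also have "\<dots> \<le> m powr (- Re s - 1)" using x m s by (intro powr_mono2') auto
    finally show "norm (- s * z powr (- s - 1)) \<le> norm s * m powr (- Re s - 1)"
      by (simp add: norm_mult mult_left_mono)
  qed (auto simp: S_def)
  thus ?thesis by (simp flip: of_real_diff)
qed

text \<open>Each term is compared with the integral of u^(-s) over the following unit interval. The
  integrals telescope to 1 / (s - 1); as Re s exceeds 1, the n-th error is at most |s| / (n + 1)^2,
  and these bounds sum to the second summand.\<close>

lemma norm_zeta_le:
  assumes s: "Re s > 1"
  shows "norm (dseries (\<lambda>_. 1) s) \<le> 1 / norm (s - 1) + norm s * (pi\<^sup>2 / 6)"
proof -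
  define e where "e = (\<lambda>n::nat. of_nat (Suc n) powr (- s) -
    (of_nat (Suc n) powr (1 - s) - of_nat (Suc (Suc n)) powr (1 - s)) / (s - 1))"
  have s1: "s \<noteq> 1" using s by auto
  have e_le: "norm (e n) \<le> norm s * (1 / (real n + 1)\<^sup>2)" for n
  proof -
    define m where "m = real (Suc n)"
    have m: "m \<ge> 1" by (simp add: m_def)
    define S where "S = closed_segment (complex_of_real (m + 1)) (of_real m)"
    \<comment> \<open>The increment of g from m to m + 1 is the error \<open>e n\<close>, and its
      derivative \<open>m powr (- s) - z powr (- s)\<close> is small on that interval. This replaces
      an explicit integral.\<close>
    define g where "g = (\<lambda>z. z * of_real m powr (- s) + z powr (1 - s) / (s - 1))"
    have S: "\<exists>x. z = of_real x \<and> x \<ge> m \<and> x \<le> m + 1" if "z \<in> S" for z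
      using that m unfolding S_def closed_segment_of_real closed_segment_eq_real_ivl by auto
    have "norm (g (of_real (m + 1)) - g (of_real m)) \<le> (norm s * m powr (- Re s - 1)) * norm (complex_of_real (m + 1) - of_real m)"
    proof (rule field_differentiable_bound[of S g "\<lambda>z. of_real m powr (- s) - z powr (- s)"])
      fix z assume "z \<in> S"
      then obtain x where x: "z = of_real x" "x \<ge> m" "x \<le> m + 1" using S by blast
      hence "z \<notin> \<real>\<^sub>\<le>\<^sub>0" using m by auto
      hence "((\<lambda>z. z * of_real m powr (- s) + z powr (1 - s) / (s - 1)) has_field_derivative
          1 * of_real m powr (- s) + ((1 - s) * z powr (1 - s - 1)) / (s - 1)) (at z)"
        by (intro DERIV_add DERIV_cdivide DERIV_cmult_right DERIV_ident has_field_derivative_powr)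
      moreover have "((1 - s) * z powr (1 - s - 1)) / (s - 1) = - (z powr (- s))"
        using s1 by (simp add: field_simps)
      ultimately show "(g has_field_derivative of_real m powr (- s) - z powr (- s)) (at z within S)"
        unfolding g_def by (simp add: has_field_derivative_at_within)
      have "norm (of_real m powr (- s) - z powr (- s)) \<le> norm s * m powr (- Re s - 1) * \<bar>m - x\<bar>"
        unfolding x(1) using m x s by (intro norm_powr_diff_le) auto
      also have "\<dots> \<le> norm s * m powr (- Re s - 1) * 1" using x by (intro mult_left_mono) auto
      finally show "norm (of_real m powr (- s) - z powr (- s)) \<le> norm s * m powr (- Re s - 1)" by simp
    qed (auto simp: S_def)
    moreover have "g (of_real (m + 1)) - g (of_real m) = e n"
      by (simp add: g_def e_def m_def algebra_simps diff_divide_distrib add_divide_distrib)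
    ultimately have "norm (e n) \<le> norm s * m powr (- Re s - 1)" by simp
    also have "m powr (- Re s - 1) \<le> m powr (- 2)" using m s by (intro powr_mono) auto
    also have "m powr (- 2) = 1 / (real n + 1)\<^sup>2"
      using m by (simp add: powr_minus powr_numeral m_def divide_inverse add.commute)
    finally show ?thesis by (simp add: mult_left_mono)
  qed
  have sq: "(\<lambda>n. norm s * (1 / (real n + 1)\<^sup>2)) sums (norm s * (pi\<^sup>2 / 6))"
    using sums_mult[OF inverse_squares_sums] by (simp add: add.commute)
  have norm_e: "norm (suminf e) \<le> norm s * (pi\<^sup>2 / 6)"
    using norm_suminf_le[OF e_le sums_summable[OF sq]] sq by (simp add: sums_iff)
  have e_sums: "e sums suminf e"
    by (rule summable_sums[OF summable_comparison_test'[OF sums_summable[OF sq]]]) (rule e_le)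
  have "(\<lambda>n. norm (of_nat n powr (1 - s) :: complex)) \<longlonglongrightarrow> 0"
    unfolding norm_of_nat_powr using s by (intro tendsto_neg_powr filterlim_real_sequentially) auto
  hence "(\<lambda>n. of_nat (Suc n) powr (1 - s) / (s - 1)) \<longlonglongrightarrow> 0 / (s - 1)"
    by (intro tendsto_divide tendsto_const LIMSEQ_Suc[of "\<lambda>n. of_nat n powr (1 - s)"] s1)
       (use s1 in \<open>auto dest: tendsto_norm_zero_cancel\<close>)
  from telescope_sums'[OF this]
  have "(\<lambda>n. (of_nat (Suc n) powr (1 - s) - of_nat (Suc (Suc n)) powr (1 - s)) / (s - 1)) sums (1 / (s - 1))"
    by (simp add: diff_divide_distrib)
  from sums_add[OF e_sums this] have "(\<lambda>n. of_nat (Suc n) powr (- s)) sums (suminf e + 1 / (s - 1))"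
    by (simp add: e_def)
  hence "(\<lambda>n. of_nat n powr (- s)) sums (suminf e + 1 / (s - 1))"
    using sums_Suc_iff[of "\<lambda>n. of_nat n powr (- s) :: complex"] by simp
  hence "dseries (\<lambda>_. 1) s = suminf e + 1 / (s - 1)" by (simp add: dseries_def sums_iff)
  also have "norm \<dots> \<le> norm s * (pi\<^sup>2 / 6) + 1 / norm (s - 1)"
    using norm_triangle_ineq[of "suminf e" "1 / (s - 1)"] norm_e by (simp add: norm_divide)
  finally show ?thesis by simp
qed

lemma holomorphic_on_suminf:
  fixes f :: "nat \<Rightarrow> complex \<Rightarrow> complex"
  assumes S: "open S" and hol: "\<And>n. f n holomorphic_on S"
    and bound: "\<And>z. z \<in> S \<Longrightarrow> \<exists>d>0. \<exists>M. cball z d \<subseteq> S \<and> summable M \<and> (\<forall>n. \<forall>w\<in>cball z d. norm (f n w) \<le> M n)"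
  shows "(\<lambda>z. \<Sum>n. f n z) holomorphic_on S"
proof (rule holomorphic_uniform_sequence[OF S])
  show "(\<lambda>z. \<Sum>n<N. f n z) holomorphic_on S" for N
    by (intro holomorphic_on_sum hol)
  fix z assume "z \<in> S"
  then obtain d M where d: "d > 0" "cball z d \<subseteq> S" "summable M" "\<And>n w. w \<in> cball z d \<Longrightarrow> norm (f n w) \<le> M n"
    using bound by meson
  have "uniform_limit (cball z d) (\<lambda>N w. \<Sum>n<N. f n w) (\<lambda>w. \<Sum>n. f n w) sequentially"
    by (rule Weierstrass_m_test[OF d(4,3)])
  with d show "\<exists>d>0. cball z d \<subseteq> S \<and> uniform_limit (cball z d) (\<lambda>N w. \<Sum>n<N. f n w) (\<lambda>w. \<Sum>n. f n w) sequentially"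
    by blast
qed

lemma cball_Re_bounds:
  assumes "w \<in> cball z d"
  shows "Re z - d \<le> Re w" "norm w \<le> norm z + d"
proof -
  have "norm (z - w) \<le> d" using assms by (simp add: dist_norm)
  moreover have "Re z - Re w \<le> norm (z - w)" using complex_Re_le_cmod[of "z - w"] by simp
  moreover have "norm w \<le> norm z + norm (z - w)" using norm_triangle_ineq4[of z "z - w"] by simp
  ultimately show "Re z - d \<le> Re w" "norm w \<le> norm z + d" by linarith+
qed

lemma holomorphic_dseries: "dseries c holomorphic_on {s. Re s > 1}" if c: "\<And>n. \<bar>c n\<bar> \<le> (1::int)"
  unfolding dseries_def
proof (rule holomorphic_on_suminf)
  show "open {s. Re s > 1}" by (rule open_halfspace_Re_gt)
  show "(\<lambda>s. of_int (c n) * of_nat n powr (- s)) holomorphic_on {s. Re s > 1}" for n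
  proof (cases "n = 0")
    case False
    thus ?thesis by (intro holomorphic_intros) auto
  qed auto
  fix z :: complex assume "z \<in> {s. Re s > 1}"
  hence z: "Re z > 1" by simp
  define d where "d = (Re z - 1) / 2"
  have d: "d > 0" "Re z - d > 1" using z by (auto simp: d_def field_simps)
  show "\<exists>d>0. \<exists>M. cball z d \<subseteq> {s. Re s > 1} \<and> summable M \<and>
      (\<forall>n. \<forall>w\<in>cball z d. norm (of_int (c n) * of_nat n powr (- w) :: complex) \<le> M n)"
  proof (intro exI[of _ d] exI[of _ "\<lambda>n. real n powr (- (Re z - d))"] conjI d allI ballI)
    show "cball z d \<subseteq> {s. Re s > 1}" using cball_Re_bounds(1) d(2) by fastforce
    show "summable (\<lambda>n. real n powr (- (Re z - d)))" using d by (simp add: summable_real_powr_iff)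
    fix n w assume w: "w \<in> cball z d"
    have "norm (of_int (c n) * of_nat n powr (- w) :: complex) \<le> real n powr (- Re w)"
      by (rule norm_dseries_term_le[OF c])
    also have "\<dots> \<le> real n powr (- (Re z - d))"
      using cball_Re_bounds(1)[OF w] by (cases "n = 0") (auto intro!: powr_mono)
    finally show "norm (of_int (c n) * of_nat n powr (- w) :: complex) \<le> real n powr (- (Re z - d))" .
  qed
qed

section \<open>Continuation and non-vanishing of the L-function\<close>

text \<open>
  Pairing the terms \<open>4 * k + 1\<close> and \<open>4 * k + 3\<close> of the series of \<^const>\<open>chi4\<close> makes it absolutely
  convergent on \<open>Re s > 0\<close>, which continues it beyond \<open>Re s > 1\<close>.
\<close>

definition L4 :: "complex \<Rightarrow> complex" where
  "L4 s = (\<Sum>k. of_nat (4 * k + 1) powr (- s) - of_nat (4 * k + 3) powr (- s))"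

text \<open>Mean value estimate with the common lower bound \<open>Suc k\<close> for both bases; the
  factor 2 is their distance.\<close>

lemma norm_L4_term_le:
  assumes "Re s \<ge> 0"
  shows "norm (of_nat (4 * k + 1) powr (- s) - of_nat (4 * k + 3) powr (- s) :: complex)
    \<le> norm s * real (Suc k) powr (- Re s - 1) * 2"
proof -
  have "norm (complex_of_real (real (4 * k + 1)) powr (- s) - of_real (real (4 * k + 3)) powr (- s))
      \<le> norm s * real (Suc k) powr (- Re s - 1) * \<bar>real (4 * k + 1) - real (4 * k + 3)\<bar>"
    by (rule norm_powr_diff_le) (use assms in auto)
  thus ?thesis by simp
qed

lemma holomorphic_L4: "L4 holomorphic_on {s. Re s > 0}"
  unfolding L4_def
proof (rule holomorphic_on_suminf)
  show "open {s. Re s > 0}" by (rule open_halfspace_Re_gt)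
  show "(\<lambda>s. of_nat (4 * k + 1) powr (- s) - of_nat (4 * k + 3) powr (- s)) holomorphic_on {s. Re s > 0}" for k
  proof -
    have "of_nat (4 * k + 1) \<noteq> (0::complex)" "of_nat (4 * k + 3) \<noteq> (0::complex)"
      unfolding of_nat_eq_0_iff by auto
    thus ?thesis by (intro holomorphic_intros)
  qed
  fix z :: complex assume "z \<in> {s. Re s > 0}"
  hence z: "Re z > 0" by simp
  define d where "d = Re z / 2"
  have d: "d > 0" "Re z - d > 0" using z by (auto simp: d_def field_simps)
  show "\<exists>d>0. \<exists>M. cball z d \<subseteq> {s. Re s > 0} \<and> summable M \<and>
      (\<forall>k. \<forall>w\<in>cball z d. norm (of_nat (4 * k + 1) powr (- w) - of_nat (4 * k + 3) powr (- w) :: complex) \<le> M k)"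
  proof (intro exI[of _ d] exI[of _ "\<lambda>k. (norm z + d) * real (Suc k) powr (- (Re z - d) - 1) * 2"] conjI d allI ballI)
    show sub: "cball z d \<subseteq> {s. Re s > 0}" using cball_Re_bounds(1) d(2) by fastforce
    have "summable (\<lambda>k. real k powr (- (Re z - d) - 1))" using d by (simp add: summable_real_powr_iff)
    hence "summable (\<lambda>k. real (Suc k) powr (- (Re z - d) - 1))" by (subst summable_Suc_iff)
    thus "summable (\<lambda>k. (norm z + d) * real (Suc k) powr (- (Re z - d) - 1) * 2)"
      by (intro summable_mult summable_mult2)
    fix k w assume w: "w \<in> cball z d"
    hence "Re w > 0" using sub by auto
    hence "norm (of_nat (4 * k + 1) powr (- w) - of_nat (4 * k + 3) powr (- w) :: complex)
      \<le> norm w * real (Suc k) powr (- Re w - 1) * 2" by (intro norm_L4_term_le) auto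
    also have "\<dots> \<le> (norm z + d) * real (Suc k) powr (- (Re z - d) - 1) * 2"
      using cball_Re_bounds[OF w] d by (intro mult_right_mono mult_mono powr_mono) auto
    finally show "norm (of_nat (4 * k + 1) powr (- w) - of_nat (4 * k + 3) powr (- w) :: complex)
      \<le> (norm z + d) * real (Suc k) powr (- (Re z - d) - 1) * 2" .
  qed
qed

lemma chi4_mod:
  "chi4 (k * 4) = 0" "chi4 (Suc (k * 4)) = 1" "chi4 (Suc (Suc (k * 4))) = 0" "chi4 (k * 4 + 3) = -1"
  unfolding chi4_def by presburger+

lemma sum_four: "sum f {k * 4..<k * 4 + 4} = f (k * 4) + f (Suc (k * 4)) + f (Suc (Suc (k * 4))) + (f (k * 4 + 3) :: 'a::comm_monoid_add)"
  by (simp add: eval_nat_numeral add_ac)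

lemma sum_two: "sum f {k * 2..<k * 2 + 2} = f (k * 2) + (f (Suc (k * 2)) :: 'a::comm_monoid_add)"
  by (simp add: eval_nat_numeral)

lemma dseries_chi4:
  assumes "Re s > 1"
  shows "dseries chi4 s = L4 s"
proof -
  have "(\<lambda>n. of_int (chi4 n) * of_nat n powr (- s)) sums dseries chi4 s"
    unfolding dseries_def
    by (rule summable_sums[OF summable_norm_cancel[OF summable_norm_dseries[OF abs_chi4_le assms]]])
  from sums_group[OF this, of 4]
  have "(\<lambda>k. of_nat (4 * k + 1) powr (- s) - of_nat (4 * k + 3) powr (- s)) sums dseries chi4 s"
    by (simp add: sum_four chi4_mod mult.commute)
  thus ?thesis by (simp add: L4_def sums_iff)
qed

lemma leibniz_sums: "(\<lambda>k. (-1) ^ k * 1 / real (k * 2 + 1)) sums (pi / 4)"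
proof -
  have "summable (\<lambda>k. (-1) ^ k * (1 / real (k * 2 + 1) * 1 ^ (k * 2 + 1)))"
    by (rule summable_arctan_series) simp
  thus ?thesis using pi_series by (simp add: sums_iff)
qed

lemma L4_1: "L4 1 = of_real (pi / 4)"
proof -
  from sums_group[OF leibniz_sums, of 2]
  have "(\<lambda>k. 1 / real (4 * k + 1) - 1 / real (4 * k + 3)) sums (pi / 4)"
    by (simp add: sum_two algebra_simps)
  hence "(\<lambda>k. complex_of_real (1 / real (4 * k + 1) - 1 / real (4 * k + 3))) sums of_real (pi / 4)"
    by (rule sums_of_real)
  moreover have "complex_of_real (1 / real (4 * k + 1) - 1 / real (4 * k + 3)) =
      of_nat (4 * k + 1) powr (- 1) - of_nat (4 * k + 3) powr (- 1)" for k
    by (simp add: powr_minus divide_inverse)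
  ultimately show ?thesis by (simp add: L4_def sums_iff)
qed

lemma L4_nonzero:
  assumes s: "Re s \<ge> 1"
  shows "L4 s \<noteq> 0"
proof (cases "Re s > 1")
  case True
  thus ?thesis using dseries_nonzero[OF chi4_mult chi4_1(1) abs_chi4_le True] dseries_chi4 by simp
next
  case False
  define t where "t = Im s"
  have s_eq: "s = Complex 1 t" using s False by (simp add: t_def complex_eq_iff)
  show ?thesis
  proof (cases "t = 0")
    case True
    hence "s = 1" by (simp add: s_eq complex_eq_iff)
    thus ?thesis by (simp add: L4_1)
  next
    case t: False
    show ?thesis
    proof
      assume zero: "L4 s = 0"
      define h where "h = (\<lambda>n. 1 / real (Suc n))"
      have h: "h n > 0" "h n \<le> 1" for n by (auto simp: h_def)
      have h0: "h \<longlonglongrightarrow> 0" unfolding h_def by (rule LIMSEQ_Suc[OF lim_1_over_n])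
      \<comment> \<open>Holomorphy across the line Re s = 1 makes a zero at s at least simple: the
        quotients L4(s + h) / h converge and so stay bounded.\<close>
      have "L4 field_differentiable at s"
        using holomorphic_on_imp_differentiable_at[OF holomorphic_L4 open_halfspace_Re_gt] s by simp
      then obtain D where "(L4 has_field_derivative D) (at s)" by (auto simp: field_differentiable_def)
      hence D: "((\<lambda>w. (L4 (s + w) - L4 s) / w) \<longlongrightarrow> D) (at 0)" by (simp add: DERIV_def)
      have "filterlim (\<lambda>n. complex_of_real (h n)) (at 0) sequentially"
        using h h0 by (auto simp: filterlim_at tendsto_of_real_iff[of _ 0, simplified] less_imp_neq[symmetric])
      from filterlim_compose[OF D this]
      have q: "(\<lambda>n. norm (L4 (s + h n) / h n)) \<longlonglongrightarrow> norm D" using zero by (simp add: tendsto_norm)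
      \<comment> \<open>At \<open>1 + h\<close> the factors of the 3-4-1 inequality are \<open>O(h\<^sup>-\<^sup>3)\<close>, \<open>O(h\<^sup>4)\<close> and \<open>O(1)\<close>.\<close>
      define B1 where "B1 = 1 + 2 * (pi\<^sup>2 / 6)"
      define B2 where "B2 = 1 / (2 * \<bar>t\<bar>) + (2 + 2 * \<bar>t\<bar>) * (pi\<^sup>2 / 6)"
      have "1 \<le> B1 ^ 3 * norm (L4 (s + h n) / h n) ^ 4 * B2 * h n" for n
      proof -
        define \<sigma> where "\<sigma> = 1 + h n"
        have \<sigma>: "\<sigma> > 1" "\<sigma> \<le> 2" using h[of n] by (auto simp: \<sigma>_def)
        have "norm (dseries (\<lambda>_. 1) \<sigma>) \<le> 1 / h n + \<sigma> * (pi\<^sup>2 / 6)"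
        proof -
          have "complex_of_real \<sigma> - 1 = of_real (h n)" by (simp add: \<sigma>_def)
          hence "norm (complex_of_real \<sigma> - 1) = h n" using h[of n] by (simp only: norm_of_real abs_of_pos)
          moreover have "norm (complex_of_real \<sigma>) = \<sigma>" using \<sigma> by simp
          ultimately show ?thesis using norm_zeta_le[of \<sigma>] \<sigma>(1) by simp
        qed
        \<comment> \<open>As h is at most 1, the bounded summand is absorbed into a multiple of 1 /
          h.\<close>
        also have "\<dots> \<le> 1 / h n + (2 / h n) * (pi\<^sup>2 / 6)"
        proof -
          have "\<sigma> * h n \<le> 2 * 1" using \<sigma> h[of n] by (intro mult_mono) auto
          hence "\<sigma> \<le> 2 / h n" using h[of n] by (simp add: field_simps)
          thus ?thesis by (intro add_left_mono mult_right_mono) auto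
        qed
        also have "\<dots> = B1 / h n" by (simp add: B1_def add_divide_distrib)
        finally have 1: "norm (dseries (\<lambda>_. 1) \<sigma>) \<le> B1 / h n" .
        have "Complex \<sigma> t = s + h n" by (simp add: s_eq \<sigma>_def complex_eq_iff)
        moreover have "dseries chi4 (Complex \<sigma> t) = L4 (Complex \<sigma> t)"
          by (rule dseries_chi4) (use \<sigma> in simp)
        ultimately have 2: "norm (dseries chi4 (Complex \<sigma> t)) = h n * norm (L4 (s + h n) / h n)"
          using h[of n] by (simp add: norm_divide)
        have "2 * \<bar>t\<bar> \<le> norm (Complex \<sigma> (2 * t) - 1)"
          using abs_Im_le_cmod[of "Complex \<sigma> (2 * t) - 1"] by (simp add: abs_mult)
        moreover have "norm (Complex \<sigma> (2 * t)) \<le> 2 + 2 * \<bar>t\<bar>"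
          using cmod_le[of "Complex \<sigma> (2 * t)"] \<sigma> by (simp add: abs_mult)
        ultimately have "1 / norm (Complex \<sigma> (2 * t) - 1) + norm (Complex \<sigma> (2 * t)) * (pi\<^sup>2 / 6) \<le> B2"
          unfolding B2_def using t by (intro add_mono mult_right_mono divide_left_mono) (auto intro!: mult_pos_pos)
        moreover have "norm (dseries (\<lambda>_. 1) (Complex \<sigma> (2 * t))) \<le> 1 / norm (Complex \<sigma> (2 * t) - 1) + norm (Complex \<sigma> (2 * t)) * (pi\<^sup>2 / 6)"
          by (rule norm_zeta_le) (use \<sigma> in simp)
        ultimately have 3: "norm (dseries (\<lambda>_. 1) (Complex \<sigma> (2 * t))) \<le> B2" by linarith
        have "1 \<le> norm (dseries (\<lambda>_. 1) \<sigma>) ^ 3 * norm (dseries chi4 (Complex \<sigma> t)) ^ 4 * norm (dseries (\<lambda>_. 1) (Complex \<sigma> (2 * t)))"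
          by (rule mertens_inequality[OF \<sigma>(1)])
        also have "\<dots> \<le> (B1 / h n) ^ 3 * norm (dseries chi4 (Complex \<sigma> t)) ^ 4 * B2"
          using 1 3 h[of n] by (intro mult_mono power_mono mult_nonneg_nonneg) (auto simp: B1_def intro!: divide_nonneg_pos)
        also have "\<dots> = B1 ^ 3 * norm (L4 (s + h n) / h n) ^ 4 * B2 * h n"
          unfolding 2 using h(1)[of n]
          by (simp add: power_mult_distrib power_divide power3_eq_cube power4_eq_xxxx)
        finally show ?thesis .
      qed
      moreover have "(\<lambda>n. B1 ^ 3 * norm (L4 (s + h n) / h n) ^ 4 * B2 * h n) \<longlonglongrightarrow> B1 ^ 3 * norm D ^ 4 * B2 * 0"
        by (intro tendsto_mult tendsto_power tendsto_const q h0)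
      ultimately have "1 \<le> B1 ^ 3 * norm D ^ 4 * B2 * 0"
        by (intro LIMSEQ_le_const) auto
      thus False by simp
    qed
  qed
qed

text \<open>The even terms make up a quarter of the full sum, leaving pi^2 / 6 - pi^2 / 24.\<close>

lemma sums_odd_inverse_squares: "(\<lambda>k. 1 / (2 * real k + 1)\<^sup>2) sums (pi\<^sup>2 / 8)"
proof -
  have all: "(\<lambda>n. 1 / (real n + 1)\<^sup>2) sums (pi\<^sup>2 / 6)"
    using inverse_squares_sums by (simp add: add.commute)
  from sums_group[OF this, of 2]
  have pairs: "(\<lambda>k. 1 / (2 * real k + 1)\<^sup>2 + 1 / (2 * (real k + 1))\<^sup>2) sums (pi\<^sup>2 / 6)"
    by (simp add: sum_two algebra_simps)
  have "1 / 4 * (1 / (real k + 1)\<^sup>2) = 1 / (2 * (real k + 1))\<^sup>2" for k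
    by (simp only: power_mult_distrib) simp
  with sums_mult[OF all, of "1/4"] have "(\<lambda>k. 1 / (2 * (real k + 1))\<^sup>2) sums (pi\<^sup>2 / 24)"
    by (simp only:) simp
  from sums_diff[OF pairs this] show ?thesis by simp
qed

lemma dseries_chi4_sq_2: "dseries (\<lambda>n. chi4 n ^ 2) 2 = of_real (pi\<^sup>2 / 8)"
proof -
  have chi2: "\<bar>chi4 n ^ 2\<bar> \<le> 1" for n using chi4_cases[of n] by auto
  have sums: "(\<lambda>n. of_int (chi4 n ^ 2) * of_nat n powr (- 2)) sums dseries (\<lambda>n. chi4 n ^ 2) 2"
    unfolding dseries_def
    by (rule summable_sums[OF summable_norm_cancel[OF summable_norm_dseries[OF chi2]]]) simp
  have "(\<lambda>k. of_nat (Suc (k * 2)) powr (- 2)) sums dseries (\<lambda>n. chi4 n ^ 2) 2"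
  proof -
    have "chi4 (k * 2) ^ 2 = 0" for k by (simp add: chi4_even)
    moreover have "chi4 (Suc (k * 2)) ^ 2 = 1" for k
      using chi4_odd[of "Suc (k * 2)"] by (simp flip: power_mult)
    ultimately show ?thesis using sums_group[OF sums, of 2]
      by (simp only: sum_two of_int_0 of_int_1) simp
  qed
  moreover have "of_nat (Suc (k * 2)) powr (- 2) = complex_of_real (1 / (2 * real k + 1)\<^sup>2)" for k
  proof -
    have "of_nat (Suc (k * 2)) powr (- 2 :: complex) = inverse (of_nat (Suc (k * 2)) ^ 2)"
      using powr_nat'[of "of_nat (Suc (k * 2))" 2] by (simp add: powr_minus del: of_nat_Suc)
    thus ?thesis by (simp add: divide_inverse mult.commute add.commute)
  qed
  ultimately have "(\<lambda>k. complex_of_real (1 / (2 * real k + 1)\<^sup>2)) sums dseries (\<lambda>n. chi4 n ^ 2) 2"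
    by (simp only:)
  thus ?thesis using sums_of_real[OF sums_odd_inverse_squares] sums_unique2 by blast
qed

section \<open>The values of the series and integrals\<close>

lemma sums_alpha0: "(\<lambda>n. real_of_int (alpha0 (Suc n)) / real (Suc n)) sums (pi / 2)"
proof -
  \<comment> \<open>The bound -1/2 comes from the numerator: 2 (1 + z) must have real part above 1.
    The denominator would allow Re z > -1.\<close>
  define H where "H = {z. Re z > - 1 / 2}"
  define U where "U = {z \<in> H. L4 (1 + z) \<noteq> 0}"
  define G where "G = (\<lambda>z. dseries (\<lambda>n. chi4 n ^ 2) (2 * (1 + z)) / L4 (1 + z))"
  have chi2: "\<bar>chi4 n ^ 2\<bar> \<le> 1" for n using chi4_cases[of n] by auto
  have H: "open H" unfolding H_def by (rule open_halfspace_Re_gt)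
  have holL: "(\<lambda>z. L4 (1 + z)) holomorphic_on H"
    by (rule holomorphic_on_compose_gen[OF _ holomorphic_L4, unfolded o_def])
       (auto intro!: holomorphic_intros simp: H_def)
  have holD: "(\<lambda>z. dseries (\<lambda>n. chi4 n ^ 2) (2 * (1 + z))) holomorphic_on H"
    by (rule holomorphic_on_compose_gen[OF _ holomorphic_dseries[OF chi2], unfolded o_def])
       (auto intro!: holomorphic_intros simp: H_def)
  have "open ((\<lambda>z. L4 (1 + z)) -` (- {0}) \<inter> H)"
    by (rule continuous_on_open_vimage[OF H, THEN iffD1, rule_format])
       (use holL in \<open>auto intro: holomorphic_on_imp_continuous_on\<close>)
  also have "(\<lambda>z. L4 (1 + z)) -` (- {0}) \<inter> H = U" by (auto simp: U_def)
  finally have U: "open U" .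
  have U_sup: "{z. Re z \<ge> 0} \<subseteq> U"
    unfolding U_def H_def by (auto intro!: L4_nonzero)
  have G: "G holomorphic_on U"
    unfolding G_def U_def
    by (intro holomorphic_on_divide holomorphic_on_subset[OF holL] holomorphic_on_subset[OF holD]) auto
  have "(\<lambda>n. of_int (alpha0 (Suc n)) / of_nat (Suc n)) sums G 0"
  proof (rule newman_tauberian[OF _ U U_sup G])
    show "norm (of_int (alpha0 (Suc n)) :: complex) \<le> 1" for n
      using abs_alpha0_le[of "Suc n"] by (simp flip: of_int_abs)
    fix z assume z: "Re z > 0"
    hence s: "Re (1 + z) > 1" by simp
    have "(\<lambda>n. of_int (alpha0 n) * of_nat n powr (- (1 + z))) sums dseries alpha0 (1 + z)"
      unfolding dseries_def
      by (rule summable_sums[OF summable_norm_cancel[OF summable_norm_dseries[OF abs_alpha0_le s]]])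
    hence "(\<lambda>n. of_int (alpha0 (Suc n)) * of_nat (Suc n) powr (- (1 + z))) sums dseries alpha0 (1 + z)"
      using sums_Suc_iff[of "\<lambda>n. of_int (alpha0 n) * of_nat n powr (- (1 + z))"] by simp
    moreover have "dseries alpha0 (1 + z) = G z"
      using dseries_alpha0_chi4[OF s] dseries_chi4[OF s] L4_nonzero[of "1 + z"] z
      by (simp add: G_def eq_divide_eq)
    ultimately show "(\<lambda>n. of_int (alpha0 (Suc n)) * of_nat (Suc n) powr (- 1 - z)) sums G z"
      by simp
  qed
  moreover have "G 0 = of_real (pi / 2)"
    by (simp add: G_def dseries_chi4_sq_2 L4_1) (simp add: power2_eq_square)
  ultimately have "(\<lambda>n. complex_of_real (real_of_int (alpha0 (Suc n)) / real (Suc n))) sums of_real (pi / 2)"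
    by (simp only: of_real_divide of_real_of_int_eq of_real_of_nat_eq)
  thus ?thesis by (simp only: sums_of_real_iff)
qed

text \<open>Grouping a convergent series in pairs keeps its sum, and the second member of each pair
  has an even argument, where \<open>alpha0\<close> is 0.\<close>

lemma zeta_hat_M_sums: "(\<lambda>k. zeta_hat_M_term (Suc k)) sums (pi / 2)"
proof -
  have "alpha0 (Suc (k * 2)) = alpha (Suc (k * 2))" "alpha0 (Suc (Suc (k * 2))) = 0" for k
    by (simp_all add: alpha0_def)
  thus ?thesis using sums_group[OF sums_alpha0, of 2]
    by (simp add: sum_two zeta_hat_M_term_def mult.commute del: of_nat_Suc of_nat_mult)
qed

lemma zeta_M_sums: "(\<lambda>k. zeta_M_term (Suc k)) sums (pi / 4)"
  using leibniz_sums by (simp add: zeta_M_term_def mult.commute)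

text \<open>The integrand is unbounded at 1, and at -1 when a = -1. The fundamental theorem for
  nonnegative integrands needs only one-sided limits of the primitive there, which arcsin has by
  continuity on the closed interval, and it yields integrability as well.\<close>

lemma arcsin_integral:
  fixes a :: real
  assumes a: "- 1 \<le> a" "a < 1"
  shows "interval_lebesgue_integrable lborel a 1 (\<lambda>x::real. 1 / sqrt (1 - x\<^sup>2))"
    and "(LBINT x=a..1. 1 / sqrt (1 - x\<^sup>2)) = pi / 2 - arcsin a"
proof -
  have lim: "(arcsin \<longlongrightarrow> arcsin y) (at y within {-1..1})" if "y \<in> {-1..1}" for y
    using continuous_on_arcsin' that by (auto simp: continuous_on_def)
  have lim_a: "((arcsin \<circ> real_of_ereal) \<longlongrightarrow> arcsin a) (at_right (ereal a))"
  proof -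
    have "(arcsin \<longlongrightarrow> arcsin a) (at_right a)"
      using tendsto_within_subset[OF lim[of a], of "{a..1}"] a at_within_Icc_at_right[of a 1] by auto
    thus ?thesis by (simp only: ereal_tendsto_simps1)
  qed
  have lim_1: "((arcsin \<circ> real_of_ereal) \<longlongrightarrow> arcsin 1) (at_left (ereal 1))"
  proof -
    have "(arcsin \<longlongrightarrow> arcsin 1) (at_left 1)"
      using tendsto_within_subset[OF lim[of 1], of "{a..1}"] a at_within_Icc_at_left[of a 1] by auto
    thus ?thesis by (simp only: ereal_tendsto_simps1)
  qed
  have pos: "1 - x\<^sup>2 > 0" if "ereal a < ereal x" "ereal x < ereal 1" for x
    using that a by (simp add: abs_square_less_1)
  have der: "DERIV arcsin x :> 1 / sqrt (1 - x\<^sup>2)" if "ereal a < ereal x" "ereal x < ereal 1" for x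
    using DERIV_arcsin[of x] that a by (simp add: divide_inverse)
  have cont: "isCont (\<lambda>x. 1 / sqrt (1 - x\<^sup>2)) x" if "ereal a < ereal x" "ereal x < ereal 1" for x
    using pos[OF that] by (intro continuous_intros) auto
  have nonneg: "AE x in lborel. ereal a < ereal x \<longrightarrow> ereal x < ereal 1 \<longrightarrow> 0 \<le> 1 / sqrt (1 - x\<^sup>2)"
    using pos by (intro AE_I2 impI) (simp add: less_imp_le)
  have "ereal a < ereal 1" using a by simp
  note FTC = interval_integral_FTC_nonneg[OF this der cont nonneg lim_a lim_1]
  show "interval_lebesgue_integrable lborel a 1 (\<lambda>x::real. 1 / sqrt (1 - x\<^sup>2))"
    using FTC(1) a by (simp add: interval_lebesgue_integrable_def one_ereal_def)
  show "(LBINT x=a..1. 1 / sqrt (1 - x\<^sup>2)) = pi / 2 - arcsin a"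
    using FTC(2) by (simp add: one_ereal_def)
qed

theorem theorem1p2:
  shows "summable (\<lambda>k. zeta_M_term (Suc k))
    \<and> zeta_M_1 = pi / 4
    \<and> summable (\<lambda>k. zeta_hat_M_term (Suc k))
    \<and> interval_lebesgue_integrable lborel (-1) 1 (\<lambda>x::real. 1 / sqrt (1 - x\<^sup>2))
    \<and> interval_lebesgue_integrable lborel 0 1 (\<lambda>x::real. 1 / sqrt (1 - x\<^sup>2))
    \<and> zeta_hat_M_1 = 1 / 2 * (LBINT x=-1..1. 1 / sqrt (1 - x\<^sup>2))
    \<and> 1 / 2 * (LBINT x=-1..1. 1 / sqrt (1 - x\<^sup>2)) = (LBINT x=0..1. 1 / sqrt (1 - x\<^sup>2))
    \<and> (LBINT x=0..1. 1 / sqrt (1 - x\<^sup>2)) = pi / 2"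
proof -
  have "ereal (-1) = -1" by (simp add: one_ereal_def)
  hence "interval_lebesgue_integrable lborel (-1) 1 (\<lambda>x::real. 1 / sqrt (1 - x\<^sup>2))"
    "(LBINT x=-1..1. 1 / sqrt (1 - x\<^sup>2)) = pi"
    using arcsin_integral[of "-1"] by simp_all
  moreover have "interval_lebesgue_integrable lborel 0 1 (\<lambda>x::real. 1 / sqrt (1 - x\<^sup>2))"
    "(LBINT x=0..1. 1 / sqrt (1 - x\<^sup>2)) = pi / 2"
    using arcsin_integral[of 0] by (simp_all add: zero_ereal_def)
  ultimately show ?thesis
    using zeta_M_sums zeta_hat_M_sums by (simp add: zeta_M_1_def zeta_hat_M_1_def sums_iff)
qed

end
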